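(* Let $X$ be a smooth vector field on an orientable $m$-dimensional smooth manifold $M$. Suppose that $X$ admits $m-1$ first integrals $h_1,\dots,h_{m-1}\in C^\infty(M)$ which are independent on an open dense subset $U\subseteq M$. Then there exist unique Poisson structures $\pi_1,\dots,\pi_{m-1}$ on $U$ of rank at most two such that $$\pi_i^\sharp\,\mathrm{d}h_j=\delta_{ij}X\quad\text{on } U,\qquad \text{for all } i,j=1,\dots,m-1 .$$ Moreover, $[\pi_i,\pi_j]=0$ for all $i$ and $j$.
   Context: A Poisson structure on a manifold is a bivector field $\pi$ with $[\pi,\pi]=0$, where $[\cdot,\cdot]$ is the Schouten–Nijenhuis bracket of multivector fields. For a bivector field $\pi$, the bundle map $\pi^\sharp:T^*M\to TM$ is $\pi^\sharp\alpha=\mathbf{i}_\alpha\pi=\pi(\alpha,\cdot)$ (so $(Y\wedge X)^\sharp\alpha=\alpha(Y)X-\alpha(X)Y$), and the rank of $\pi$ at $x$ is $\dim\pi^\sharp(T^*_xM)$. A first integral of $X$ is a function $h\in C^\infty(M)$ with $\mathrm{d}h(X)=0$. Functions are independent on $U$ if their differentials are linearly independent at every point of $U$. $\delta_{ij}$ is the Kronecker delta. *)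

theory Defs
  imports
    "HOL-Analysis.Analysis"
    "HOL-Combinatorics.Permutations"
    "HOL-Library.Function_Algebras"
    "HOL-Library.FuncSet"
begin

section \<open>Functions with values in a real vector space\<close>

text \<open>Tangent and cotangent vectors are represented below by functions, so the pointwise vector
  space structure makes \<^const>\<open>dim\<close> and linear combinations available for them.\<close>

instantiation "fun" :: (type, real_vector) real_vector
begin

definition scaleR_fun :: "real \<Rightarrow> ('a \<Rightarrow> 'b) \<Rightarrow> 'a \<Rightarrow> 'b" where
  "scaleR_fun r f = (\<lambda>x. r *\<^sub>R f x)"

instance
  by standard (auto simp: scaleR_fun_def fun_eq_iff scaleR_add_right scaleR_add_left)

end

section \<open>Smoothness on open subsets of normed spaces\<close>

text \<open>Only used for open sets \<open>S\<close> in a finite-dimensional space.\<close>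

primrec Ck_on ::
  "nat \<Rightarrow> 'a::real_normed_vector set \<Rightarrow> ('a \<Rightarrow> 'b::real_normed_vector) \<Rightarrow> bool" where
  "Ck_on 0 S f \<longleftrightarrow> continuous_on S f"
| "Ck_on (Suc k) S f \<longleftrightarrow>
     f differentiable_on S \<and> (\<forall>v. Ck_on k S (\<lambda>x. frechet_derivative f (at x) v))"

definition Cinf_on ::
  "'a::real_normed_vector set \<Rightarrow> ('a \<Rightarrow> 'b::real_normed_vector) \<Rightarrow> bool" where
  "Cinf_on S f \<longleftrightarrow> (\<forall>k. Ck_on k S f)"

section \<open>Smooth manifolds\<close>

type_synonym ('a, 'n) chart = "'a set \<times> ('a \<Rightarrow> real ^ 'n)"

definition is_chart :: "'a topology \<Rightarrow> ('a, 'n::finite) chart \<Rightarrow> bool" where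
  "is_chart M c \<longleftrightarrow> openin M (fst c) \<and> open (snd c ` fst c) \<and>
     homeomorphic_map (subtopology M (fst c)) (top_of_set (snd c ` fst c)) (snd c)"

definition chart_inv :: "('a, 'n::finite) chart \<Rightarrow> real ^ 'n \<Rightarrow> 'a" where
  "chart_inv c = inv_into (fst c) (snd c)"

definition transition ::
  "('a, 'n::finite) chart \<Rightarrow> ('a, 'n) chart \<Rightarrow> real ^ 'n \<Rightarrow> real ^ 'n" where
  "transition c d = snd d \<circ> chart_inv c"

definition compatible :: "('a, 'n::finite) chart \<Rightarrow> ('a, 'n) chart \<Rightarrow> bool" where
  "compatible c d \<longleftrightarrow>
     Cinf_on (snd c ` (fst c \<inter> fst d)) (transition c d) \<and>
     Cinf_on (snd d ` (fst c \<inter> fst d)) (transition d c)"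

text \<open>A smooth manifold of dimension \<^term>\<open>CARD('n)\<close> is a second countable Hausdorff space with a
  maximal smooth atlas \<open>A\<close>. The values of a chart map outside its domain play no role.\<close>

definition smooth_manifold :: "'a topology \<Rightarrow> ('a, 'n::finite) chart set \<Rightarrow> bool" where
  "smooth_manifold M A \<longleftrightarrow>
     Hausdorff_space M \<and> second_countable M \<and>
     (\<forall>c\<in>A. is_chart M c) \<and> \<Union> (fst ` A) = topspace M \<and>
     (\<forall>c\<in>A. \<forall>d\<in>A. compatible c d) \<and>
     (\<forall>c. is_chart M c \<and> (\<forall>d\<in>A. compatible c d) \<longrightarrow> c \<in> A)"

definition orientable :: "('a, 'n::finite) chart set \<Rightarrow> bool" where
  "orientable A \<longleftrightarrow>
     (\<exists>B\<subseteq>A. \<Union> (fst ` B) = \<Union> (fst ` A) \<and>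
       (\<forall>c\<in>B. \<forall>d\<in>B. \<forall>x\<in>fst c \<inter> fst d.
          det (matrix (frechet_derivative (transition c d) (at (snd c x)))) > 0))"

definition smooth_map_on ::
  "('a, 'n::finite) chart set \<Rightarrow> 'a set \<Rightarrow> ('a \<Rightarrow> 'b::real_normed_vector) \<Rightarrow> bool" where
  "smooth_map_on A W f \<longleftrightarrow> (\<forall>c\<in>A. Cinf_on (snd c ` (fst c \<inter> W)) (f \<circ> chart_inv c))"

section \<open>Tangent and cotangent vectors\<close>

text \<open>A tangent vector at \<open>x\<close> assigns to each chart around \<open>x\<close> a coordinate vector, subject to the
  usual transformation law, and is \<open>0\<close> on all other pairs. A cotangent vector is a linear form on
  the tangent space, extended by \<open>0\<close>. These extensions by \<open>0\<close> make equality of (co)tangent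
  vectors the equality of HOL functions.\<close>

type_synonym ('a, 'n) tangent = "('a, 'n) chart \<Rightarrow> real ^ 'n"
type_synonym ('a, 'n) cotangent = "('a, 'n) tangent \<Rightarrow> real"

definition tangent_space :: "('a, 'n::finite) chart set \<Rightarrow> 'a \<Rightarrow> ('a, 'n) tangent set" where
  "tangent_space A x =
     {v. (\<forall>c. \<not> (c \<in> A \<and> x \<in> fst c) \<longrightarrow> v c = 0) \<and>
         (\<forall>c\<in>A. \<forall>d\<in>A. x \<in> fst c \<inter> fst d \<longrightarrow>
            v d = frechet_derivative (transition c d) (at (snd c x)) (v c))}"

definition cotangent_space :: "('a, 'n::finite) chart set \<Rightarrow> 'a \<Rightarrow> ('a, 'n) cotangent set" where
  "cotangent_space A x =
     {\<alpha>. (\<forall>v. v \<notin> tangent_space A x \<longrightarrow> \<alpha> v = 0) \<and>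
         (\<forall>v\<in>tangent_space A x. \<forall>w\<in>tangent_space A x. \<alpha> (v + w) = \<alpha> v + \<alpha> w) \<and>
         (\<forall>v\<in>tangent_space A x. \<forall>r. \<alpha> (r *\<^sub>R v) = r * \<alpha> v)}"

text \<open>The differential at \<open>x\<close> of a function that is smooth near \<open>x\<close>; by the transformation law it
  does not depend on the chart that is chosen.\<close>

definition differential ::
  "('a, 'n::finite) chart set \<Rightarrow> ('a \<Rightarrow> real) \<Rightarrow> 'a \<Rightarrow> ('a, 'n) cotangent" where
  "differential A f x =
     (\<lambda>v. if v \<in> tangent_space A x
          then let c = (SOME c. c \<in> A \<and> x \<in> fst c)
               in frechet_derivative (f \<circ> chart_inv c) (at (snd c x)) (v c)
          else 0)"

definition vector_field ::
  "('a, 'n::finite) chart set \<Rightarrow> 'a set \<Rightarrow> ('a \<Rightarrow> ('a, 'n) tangent) \<Rightarrow> bool" where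
  "vector_field A W X \<longleftrightarrow>
     (\<forall>x\<in>W. X x \<in> tangent_space A x) \<and>
     (\<forall>c\<in>A. smooth_map_on A (fst c \<inter> W) (\<lambda>x. X x c))"

definition first_integral ::
  "('a, 'n::finite) chart set \<Rightarrow> 'a set \<Rightarrow> ('a \<Rightarrow> ('a, 'n) tangent) \<Rightarrow> ('a \<Rightarrow> real) \<Rightarrow> bool" where
  "first_integral A W X f \<longleftrightarrow>
     smooth_map_on A W f \<and> (\<forall>x\<in>W. differential A f x (X x) = 0)"

definition independent_functions_on ::
  "('a, 'n::finite) chart set \<Rightarrow> 'a set \<Rightarrow> nat set \<Rightarrow> (nat \<Rightarrow> 'a \<Rightarrow> real) \<Rightarrow> bool" where
  "independent_functions_on A W I f \<longleftrightarrow>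
     (\<forall>x\<in>W. \<forall>r. (\<Sum>i\<in>I. r i *\<^sub>R differential A (f i) x) = 0 \<longrightarrow> (\<forall>i\<in>I. r i = 0))"

section \<open>Multivector fields\<close>

text \<open>A \<open>k\<close>-vector at \<open>x\<close> is an alternating \<open>k\<close>-linear form on the cotangent space; its arguments
  are collected in a list, and it is extended by \<open>0\<close> to all other lists.\<close>

type_synonym ('a, 'n) multivector = "('a, 'n) cotangent list \<Rightarrow> real"

definition multivectors ::
  "('a, 'n::finite) chart set \<Rightarrow> nat \<Rightarrow> 'a \<Rightarrow> ('a, 'n) multivector set" where
  "multivectors A k x =
     {P. (\<forall>\<alpha>s. \<not> (length \<alpha>s = k \<and> set \<alpha>s \<subseteq> cotangent_space A x) \<longrightarrow> P \<alpha>s = 0) \<and>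
         (\<forall>\<alpha>s i r s. \<forall>\<beta>\<in>cotangent_space A x. \<forall>\<gamma>\<in>cotangent_space A x.
            length \<alpha>s = k \<and> set \<alpha>s \<subseteq> cotangent_space A x \<and> i < k \<longrightarrow>
            P (\<alpha>s[i := r *\<^sub>R \<beta> + s *\<^sub>R \<gamma>]) = r * P (\<alpha>s[i := \<beta>]) + s * P (\<alpha>s[i := \<gamma>])) \<and>
         (\<forall>\<alpha>s i j. length \<alpha>s = k \<and> set \<alpha>s \<subseteq> cotangent_space A x \<and>
            i < j \<and> j < k \<and> \<alpha>s ! i = \<alpha>s ! j \<longrightarrow> P \<alpha>s = 0)}"

text \<open>Smoothness is tested on differentials of local functions, which include the coordinate
  functions. Fields on \<open>W\<close> are extended by \<open>0\<close> outside \<open>W\<close>.\<close>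

definition multivector_field :: "'a topology \<Rightarrow> ('a, 'n::finite) chart set \<Rightarrow> 'a set \<Rightarrow> nat \<Rightarrow>
    ('a \<Rightarrow> ('a, 'n) multivector) \<Rightarrow> bool" where
  "multivector_field M A W k P \<longleftrightarrow>
     (\<forall>x\<in>W. P x \<in> multivectors A k x) \<and> (\<forall>x. x \<notin> W \<longrightarrow> P x = 0) \<and>
     (\<forall>V fs. openin M V \<and> V \<subseteq> W \<and> length fs = k \<and> (\<forall>f\<in>set fs. smooth_map_on A V f) \<longrightarrow>
        smooth_map_on A V (\<lambda>x. P x (map (\<lambda>f. differential A f x) fs)))"

subsection \<open>The Schouten--Nijenhuis bracket\<close>

text \<open>\<open>unshuffles q n\<close> is the set of permutations of \<open>{0..<n}\<close> that increase on \<open>{0..<q}\<close> and on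
  \<open>{q..<n}\<close>.\<close>

definition unshuffles :: "nat \<Rightarrow> nat \<Rightarrow> (nat \<Rightarrow> nat) set" where
  "unshuffles q n = {\<sigma>. \<sigma> permutes {0..<n} \<and> strict_mono_on {0..<q} \<sigma> \<and> strict_mono_on {q..<n} \<sigma>}"

text \<open>For functions \<open>f\<^sub>0, \<dots>, f\<^sub>n\<^sub>-\<^sub>1\<close> with \<open>n = p + q - 1\<close>, viewing \<open>P\<close> and \<open>Q\<close> as
  multiderivations, the following is
  \<open>\<Sum>\<sigma>. sign \<sigma> * P (Q (f\<^sub>\<sigma>\<^sub>(\<^sub>0\<^sub>), \<dots>, f\<^sub>\<sigma>\<^sub>(\<^sub>q\<^sub>-\<^sub>1\<^sub>)), f\<^sub>\<sigma>\<^sub>(\<^sub>q\<^sub>), \<dots>, f\<^sub>\<sigma>\<^sub>(\<^sub>n\<^sub>-\<^sub>1\<^sub>))\<close>. Nothing can be inserted into a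
  field of degree \<open>0\<close>.\<close>

definition insertion :: "('a, 'n::finite) chart set \<Rightarrow>
    nat \<Rightarrow> ('a \<Rightarrow> ('a, 'n) multivector) \<Rightarrow> nat \<Rightarrow> ('a \<Rightarrow> ('a, 'n) multivector) \<Rightarrow>
    ('a \<Rightarrow> real) list \<Rightarrow> 'a \<Rightarrow> real" where
  "insertion A p P q Q fs x =
     (if p = 0 then 0 else
        (\<Sum>\<sigma>\<in>unshuffles q (p + q - 1). of_int (sign \<sigma>) *
           P x (differential A
                  (\<lambda>y. Q y (map (\<lambda>i. differential A (fs ! \<sigma> i) y) [0..<q])) x
                # map (\<lambda>i. differential A (fs ! \<sigma> i) x) [q..<p + q - 1])))"

text \<open>The exponent below has the parity of \<open>(p - 1) * (q - 1)\<close>.\<close>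

definition schouten_on_functions :: "('a, 'n::finite) chart set \<Rightarrow>
    nat \<Rightarrow> ('a \<Rightarrow> ('a, 'n) multivector) \<Rightarrow> nat \<Rightarrow> ('a \<Rightarrow> ('a, 'n) multivector) \<Rightarrow>
    ('a \<Rightarrow> real) list \<Rightarrow> 'a \<Rightarrow> real" where
  "schouten_on_functions A p P q Q fs x =
     insertion A p P q Q fs x - (-1) ^ ((p + 1) * (q + 1)) * insertion A q Q p P fs x"

text \<open>The bracket of a \<open>p\<close>-vector field \<open>P\<close> and a \<open>q\<close>-vector field \<open>Q\<close> on \<open>W\<close>, as a
  \<open>(p + q - 1)\<close>-vector field on \<open>W\<close>. Its value at \<open>x\<close> on given covectors is the common value of the
  multiderivation on all local functions having these covectors as differentials at \<open>x\<close>.\<close>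

definition schouten :: "'a topology \<Rightarrow> ('a, 'n::finite) chart set \<Rightarrow> 'a set \<Rightarrow>
    nat \<Rightarrow> ('a \<Rightarrow> ('a, 'n) multivector) \<Rightarrow> nat \<Rightarrow> ('a \<Rightarrow> ('a, 'n) multivector) \<Rightarrow>
    'a \<Rightarrow> ('a, 'n) multivector" where
  "schouten M A W p P q Q = (\<lambda>x \<alpha>s.
     if x \<in> W \<and> length \<alpha>s = p + q - 1 \<and> set \<alpha>s \<subseteq> cotangent_space A x
     then THE r. \<forall>fs. (\<forall>f\<in>set fs. \<exists>V. openin M V \<and> x \<in> V \<and> smooth_map_on A V f) \<and>
                      map (\<lambda>f. differential A f x) fs = \<alpha>s \<longrightarrow>
                      r = schouten_on_functions A p P q Q fs x
     else 0)"

section \<open>Poisson structures\<close>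

definition poisson_structure :: "'a topology \<Rightarrow> ('a, 'n::finite) chart set \<Rightarrow> 'a set \<Rightarrow>
    ('a \<Rightarrow> ('a, 'n) multivector) \<Rightarrow> bool" where
  "poisson_structure M A W P \<longleftrightarrow> multivector_field M A W 2 P \<and> schouten M A W 2 P 2 P = 0"

text \<open>The vector \<open>P(\<alpha>, \<cdot>)\<close>, under the identification of the tangent space with its bidual.\<close>

definition sharp :: "('a, 'n::finite) chart set \<Rightarrow> ('a \<Rightarrow> ('a, 'n) multivector) \<Rightarrow> 'a \<Rightarrow>
    ('a, 'n) cotangent \<Rightarrow> ('a, 'n) tangent" where
  "sharp A P x \<alpha> =
     (THE v. v \<in> tangent_space A x \<and> (\<forall>\<beta>\<in>cotangent_space A x. \<beta> v = P x [\<alpha>, \<beta>]))"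

definition bivector_rank :: "('a, 'n::finite) chart set \<Rightarrow> ('a \<Rightarrow> ('a, 'n) multivector) \<Rightarrow> 'a \<Rightarrow> nat"
  where "bivector_rank A P x = dim (sharp A P x ` cotangent_space A x)"

end

(* Where the differentials d h_j are independent, their common kernel is a line containing X. Hence
   if d h_j(Y_i) = delta_ij, then Y_i is determined up to that line and pi_i = Y_i /\ X does not
   depend on the choice; its values on the d h_j and one further covector are forced, which gives
   uniqueness. For the brackets, complete the h_j near a point by a coordinate function g of a chart
   to a family with invertible Jacobian. The dual vector fields E_1, ..., E_{m-1}, Z commute, since
   their commutators kill all members of the family, and pi_i = u E_i /\ Z with u = X(g). As
   Z is a factor of every pi_i, the Jacobiator of pi_i and pi_j vanishes identically. *)

theory Submission
  imports Defs
begin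

section \<open>Calculus of smooth functions\<close>

text \<open>The family completed by \<open>g\<close> is never turned into a new chart. Only the
  invertibility of its Jacobian enters: Cramer's rule gives the dual frame in the original chart as
  quotients of smooth functions, and the frame commutes by the symmetry of second derivatives,
  proved below for the directional derivatives that occur in \<open>Ck_on\<close>. The coefficient u
  is there because \<open>X\<close> may vanish on \<open>U\<close> and then cannot be a frame
  vector. The Y_i are chosen point by point and need not be smooth; smoothness of the bivector
  fields is read off from the local form u E_i wedge Z. The bracket of pi_i and pi_j is a polarised
  Jacobiator, so one computation yields both the Poisson property (i = j) and the mixed brackets. As
  \<open>schouten\<close> is a definite description over all local functions with prescribed
  differentials, its vanishing also needs such functions to exist.\<close>

lemma frechet_derivative_cong_open:
  assumes "open S" "x \<in> S" "\<And>y. y \<in> S \<Longrightarrow> f y = g y"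
  shows "frechet_derivative f (at x) = frechet_derivative g (at x)"
proof -
  have "(f has_derivative D) (at x) \<longleftrightarrow> (g has_derivative D) (at x)" for D
    using has_derivative_transform_within_open[of f D x UNIV S g]
      has_derivative_transform_within_open[of g D x UNIV S f] assms by auto
  then show ?thesis
    by (simp add: frechet_derivative_def)
qed

text \<open>Openness is what makes this work: the derivatives inside \<open>Ck_on\<close> are taken
  at \<open>x\<close> in the full space, so \<open>f\<close> and \<open>g\<close> must agree on a
  neighbourhood.\<close>

lemma Ck_on_cong:
  assumes "open S" "\<And>x. x \<in> S \<Longrightarrow> f x = g x" "Ck_on k S f"
  shows "Ck_on k S g"
  using assms(2,3)
proof (induction k arbitrary: f g)
  case 0
  then show ?case
    by (simp cong: continuous_on_cong)
next
  case (Suc k)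
  have "g differentiable_on S"
    using Suc.prems(2) has_derivative_transform[of _ S g f] Suc.prems(1)
    by (simp add: differentiable_on_def differentiable_def) metis
  moreover have "Ck_on k S (\<lambda>x. frechet_derivative g (at x) v)" for v
  proof (rule Suc.IH)
    show "Ck_on k S (\<lambda>x. frechet_derivative f (at x) v)"
      using Suc.prems by simp
    show "frechet_derivative f (at x) v = frechet_derivative g (at x) v" if "x \<in> S" for x
      using frechet_derivative_cong_open[OF assms(1) that, of f g] Suc.prems(1) by simp
  qed
  ultimately show ?case by simp
qed

lemma Ck_on_subset: "Ck_on k S f \<Longrightarrow> T \<subseteq> S \<Longrightarrow> Ck_on k T f"
  proof (induction k arbitrary: f)
  case 0
  then show ?case by (simp add: continuous_on_subset[of S])
next
  case (Suc k)
  then show ?case using differentiable_on_subset[of f S T] by simp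
qed

text \<open>Lets smoothness be checked near each point, which is all that is available for the
  bivector fields: their local frames depend on the point.\<close>

lemma Ck_on_local:
  assumes "open S" "\<And>x. x \<in> S \<Longrightarrow> \<exists>T. open T \<and> x \<in> T \<and> Ck_on k T f"
  shows "Ck_on k S f"
  using assms(2)
proof (induction k arbitrary: f)
  case 0
  then show ?case
    by (simp add: continuous_on_eq_continuous_at[OF assms(1)])
      (metis continuous_on_eq_continuous_at)
next
  case (Suc k)
  have "f differentiable (at x)" if "x \<in> S" for x
    using Suc.prems[OF that] by (metis Ck_on.simps(2) differentiable_on_def at_within_open)
  then have "f differentiable_on S"
    by (auto simp: differentiable_on_def at_within_open[OF _ assms(1)])
  moreover have "Ck_on k S (\<lambda>x. frechet_derivative f (at x) v)" for v
    by (rule Suc.IH) (use Suc.prems in \<open>metis Ck_on.simps(2)\<close>)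
  ultimately show ?case by simp
qed

text \<open>Leibniz rules leave one factor undifferentiated, so the inductions for products and
  reciprocals have to lower the order of that factor.\<close>

lemma Ck_on_SucD: "Ck_on (Suc k) S f \<Longrightarrow> Ck_on k S f"
  proof (induction k arbitrary: f)
  case (Suc k)
  then show ?case unfolding Ck_on.simps(2)[of "Suc k"] Ck_on.simps(2)[of k] by blast
qed (simp add: differentiable_imp_continuous_on)

lemma Ck_on_const: "Ck_on k S (\<lambda>x. c)"
  by (induction k arbitrary: c) (simp_all add: continuous_on_const)

lemma Ck_on_bounded_linear:
  assumes "open S" "bounded_linear L" "Ck_on k S f"
  shows "Ck_on k S (\<lambda>x. L (f x))"
  using assms(3)
proof (induction k arbitrary: f)
  case 0
  then show ?case
    using bounded_linear.continuous_on[OF assms(2)] by auto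
next
  case (Suc k)
  have d: "((\<lambda>x. L (f x)) has_derivative (\<lambda>v. L (frechet_derivative f (at x) v))) (at x)"
    if "x \<in> S" for x
    using Suc.prems that
    by (intro bounded_linear.has_derivative[OF assms(2)])
      (auto simp: differentiable_on_def at_within_open[OF _ assms(1)] frechet_derivative_works)
  show ?case
    unfolding Ck_on.simps
  proof (intro conjI allI)
    show "(\<lambda>x. L (f x)) differentiable_on S"
      using d by (auto simp: differentiable_on_def at_within_open[OF _ assms(1)] differentiable_def)
    show "Ck_on k S (\<lambda>x. frechet_derivative (\<lambda>x. L (f x)) (at x) v)" for v
    proof (rule Ck_on_cong[OF assms(1) fun_cong[OF frechet_derivative_at[OF d]]])
      show "Ck_on k S (\<lambda>x. L (frechet_derivative f (at x) v))"
        using Suc.prems by (intro Suc.IH) auto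
    qed
  qed
qed

lemma Ck_on_add:
  assumes "open S" "Ck_on k S f" "Ck_on k S g"
  shows "Ck_on k S (\<lambda>x. f x + g x)"
  using assms(2,3)
proof (induction k arbitrary: f g)
  case 0
  then show ?case by (auto intro: continuous_on_add)
next
  case (Suc k)
  have d: "((\<lambda>x. f x + g x) has_derivative
      (\<lambda>v. frechet_derivative f (at x) v + frechet_derivative g (at x) v)) (at x)"
    if "x \<in> S" for x
    using Suc.prems that
    by (intro has_derivative_add)
      (auto simp: differentiable_on_def at_within_open[OF _ assms(1)] frechet_derivative_works)
  show ?case
    unfolding Ck_on.simps
  proof (intro conjI allI)
    show "(\<lambda>x. f x + g x) differentiable_on S"
      using d by (auto simp: differentiable_on_def at_within_open[OF _ assms(1)] differentiable_def)
    show "Ck_on k S (\<lambda>x. frechet_derivative (\<lambda>x. f x + g x) (at x) v)" for v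
    proof (rule Ck_on_cong[OF assms(1) fun_cong[OF frechet_derivative_at[OF d]]])
      show "Ck_on k S (\<lambda>x. frechet_derivative f (at x) v + frechet_derivative g (at x) v)"
        using Suc.prems by (intro Suc.IH) auto
    qed
  qed
qed

text \<open>The derivative of \<open>B (f x) (g x)\<close> is a sum of two expressions of the same
  kind, each with one differentiated factor; the induction hypothesis covers both because
  \<open>f\<close> and \<open>g\<close> vary in it.\<close>

lemma Ck_on_bilinear:
  assumes "open S" "bounded_bilinear B" "Ck_on k S f" "Ck_on k S g"
  shows "Ck_on k S (\<lambda>x. B (f x) (g x))"
  using assms(3,4)
proof (induction k arbitrary: f g)
  case 0
  then show ?case by (auto intro: bounded_bilinear.continuous_on[OF assms(2)])
next
  case (Suc k)
  have d: "((\<lambda>x. B (f x) (g x)) has_derivative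
      (\<lambda>v. B (f x) (frechet_derivative g (at x) v) + B (frechet_derivative f (at x) v) (g x))) (at x)"
    if "x \<in> S" for x
    using Suc.prems that
    by (intro bounded_bilinear.FDERIV[OF assms(2)])
      (auto simp: differentiable_on_def at_within_open[OF _ assms(1)] frechet_derivative_works)
  show ?case
    unfolding Ck_on.simps
  proof (intro conjI allI)
    show "(\<lambda>x. B (f x) (g x)) differentiable_on S"
      using d by (auto simp: differentiable_on_def at_within_open[OF _ assms(1)] differentiable_def)
    show "Ck_on k S (\<lambda>x. frechet_derivative (\<lambda>x. B (f x) (g x)) (at x) v)" for v
    proof (rule Ck_on_cong[OF assms(1) fun_cong[OF frechet_derivative_at[OF d]]])
      show "Ck_on k S (\<lambda>x. B (f x) (frechet_derivative g (at x) v) +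
          B (frechet_derivative f (at x) v) (g x))"
        using Suc.prems Ck_on_SucD[OF Suc.prems(1)] Ck_on_SucD[OF Suc.prems(2)]
        by (intro Ck_on_add[OF assms(1)] Suc.IH) auto
    qed
  qed
qed

text \<open>The derivative of 1/f contains 1/f itself twice and the derivative of \<open>f\<close>
  once, so the hypothesis about the reciprocal closes the step and \<open>f\<close> can stay
  fixed.\<close>

lemma Ck_on_inverse:
  fixes f :: "'a::real_normed_vector \<Rightarrow> real"
  assumes "open S" "\<And>x. x \<in> S \<Longrightarrow> f x \<noteq> 0" "Ck_on k S f"
  shows "Ck_on k S (\<lambda>x. inverse (f x))"
  using assms(3)
proof (induction k)
  case 0
  then show ?case using assms(2) by (simp add: continuous_on_inverse)
next
  case (Suc k)
  have d: "((\<lambda>x. inverse (f x)) has_derivative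
      (\<lambda>v. - (inverse (f x) * frechet_derivative f (at x) v * inverse (f x)))) (at x)"
    if "x \<in> S" for x
    using Suc.prems that assms(2)
    by (intro Deriv.has_derivative_inverse)
      (auto simp: differentiable_on_def at_within_open[OF _ assms(1)] frechet_derivative_works)
  show ?case
    unfolding Ck_on.simps
  proof (intro conjI allI)
    show "(\<lambda>x. inverse (f x)) differentiable_on S"
      using d by (auto simp: differentiable_on_def at_within_open[OF _ assms(1)] differentiable_def)
    show "Ck_on k S (\<lambda>x. frechet_derivative (\<lambda>x. inverse (f x)) (at x) v)" for v
    proof (rule Ck_on_cong[OF assms(1) fun_cong[OF frechet_derivative_at[OF d]]])
      have "Ck_on k S (\<lambda>x. frechet_derivative f (at x) v)" "Ck_on k S (\<lambda>x. inverse (f x))"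
        using Suc.IH[OF Ck_on_SucD[OF Suc.prems]] Suc.prems by auto
      then show "Ck_on k S (\<lambda>x. - (inverse (f x) * frechet_derivative f (at x) v * inverse (f x)))"
        by (intro Ck_on_bounded_linear[OF assms(1) bounded_linear_minus[OF bounded_linear_ident]]
          Ck_on_bilinear[OF assms(1) bounded_bilinear_mult])
    qed
  qed
qed

section \<open>Closure properties of smooth maps\<close>

lemma Cinf_on_cong:
  "open S \<Longrightarrow> (\<And>x. x \<in> S \<Longrightarrow> f x = g x) \<Longrightarrow> Cinf_on S f \<longleftrightarrow> Cinf_on S g"
  unfolding Cinf_on_def using Ck_on_cong[of S f g] Ck_on_cong[of S g f] by auto

lemma Cinf_on_subset: "Cinf_on S f \<Longrightarrow> T \<subseteq> S \<Longrightarrow> Cinf_on T f"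
  by (simp add: Cinf_on_def Ck_on_subset[of _ S])

lemma Cinf_on_local:
  assumes "open S" "\<And>x. x \<in> S \<Longrightarrow> \<exists>T. open T \<and> x \<in> T \<and> Cinf_on T f"
  shows "Cinf_on S f"
  unfolding Cinf_on_def
proof
  show "Ck_on k S f" for k
    using assms(2) by (intro Ck_on_local[OF assms(1)]) (metis Cinf_on_def)
qed

lemma Cinf_on_imp_continuous_on: "Cinf_on S f \<Longrightarrow> continuous_on S f"
  unfolding Cinf_on_def by (metis Ck_on.simps(1))

lemma Cinf_on_imp_differentiable:
  "Cinf_on S f \<Longrightarrow> open S \<Longrightarrow> x \<in> S \<Longrightarrow> f differentiable (at x)"
  unfolding Cinf_on_def by (metis Ck_on.simps(2) differentiable_on_def at_within_open)

lemma Cinf_on_imp_has_derivative: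
  "Cinf_on S f \<Longrightarrow> open S \<Longrightarrow> x \<in> S \<Longrightarrow> (f has_derivative frechet_derivative f (at x)) (at x)"
  by (simp add: Cinf_on_imp_differentiable flip: frechet_derivative_works)

lemma Cinf_on_derivative:
  "Cinf_on S f \<Longrightarrow> Cinf_on S (\<lambda>x. frechet_derivative f (at x) v)"
  unfolding Cinf_on_def by (metis Ck_on.simps(2))

lemma Cinf_on_const: "Cinf_on S (\<lambda>x. c)"
  by (simp add: Cinf_on_def Ck_on_const)

lemma Cinf_on_bounded_linear:
  "open S \<Longrightarrow> bounded_linear L \<Longrightarrow> Cinf_on S f \<Longrightarrow> Cinf_on S (\<lambda>x. L (f x))"
  by (simp add: Cinf_on_def Ck_on_bounded_linear)

lemma Cinf_on_ident: "Cinf_on S (\<lambda>x. x)"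
  unfolding Cinf_on_def
proof
  show "Ck_on k S (\<lambda>x. x)" for k
    by (cases k) (auto simp: Ck_on_const)
qed

lemma Cinf_on_add:
  "open S \<Longrightarrow> Cinf_on S f \<Longrightarrow> Cinf_on S g \<Longrightarrow> Cinf_on S (\<lambda>x. f x + g x)"
  by (simp add: Cinf_on_def Ck_on_add)

lemma Cinf_on_minus: "open S \<Longrightarrow> Cinf_on S f \<Longrightarrow> Cinf_on S (\<lambda>x. - f x)"
  by (rule Cinf_on_bounded_linear[OF _ bounded_linear_minus[OF bounded_linear_ident]])

lemma Cinf_on_diff:
  "open S \<Longrightarrow> Cinf_on S f \<Longrightarrow> Cinf_on S g \<Longrightarrow> Cinf_on S (\<lambda>x. f x - g x)"
  using Cinf_on_add[of S f "\<lambda>x. - g x"] by (simp add: Cinf_on_minus)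

lemma Cinf_on_scaleR:
  "open S \<Longrightarrow> Cinf_on S f \<Longrightarrow> Cinf_on S g \<Longrightarrow> Cinf_on S (\<lambda>x. f x *\<^sub>R g x)"
  by (simp add: Cinf_on_def Ck_on_bilinear[OF _ bounded_bilinear_scaleR])

lemma Cinf_on_mult:
  fixes f g :: "'a::real_normed_vector \<Rightarrow> real"
  shows "open S \<Longrightarrow> Cinf_on S f \<Longrightarrow> Cinf_on S g \<Longrightarrow> Cinf_on S (\<lambda>x. f x * g x)"
  by (simp add: Cinf_on_def Ck_on_bilinear[OF _ bounded_bilinear_mult])

lemma Cinf_on_divide:
  fixes f g :: "'a::real_normed_vector \<Rightarrow> real"
  assumes "open S" "Cinf_on S f" "Cinf_on S g" "\<And>x. x \<in> S \<Longrightarrow> g x \<noteq> 0"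
  shows "Cinf_on S (\<lambda>x. f x / g x)"
  unfolding divide_inverse
  using assms by (intro Cinf_on_mult) (auto simp: Cinf_on_def intro: Ck_on_inverse)

lemma Cinf_on_sum:
  assumes "open S" "\<And>i. i \<in> I \<Longrightarrow> Cinf_on S (f i)"
  shows "Cinf_on S (\<lambda>x. \<Sum>i\<in>I. f i x)"
  using assms(2)
  by (induction I rule: infinite_finite_induct) (auto simp: Cinf_on_const intro: Cinf_on_add assms(1))

lemma Cinf_on_prod:
  fixes f :: "'i \<Rightarrow> 'a::real_normed_vector \<Rightarrow> real"
  assumes "open S" "\<And>i. i \<in> I \<Longrightarrow> Cinf_on S (f i)"
  shows "Cinf_on S (\<lambda>x. \<Prod>i\<in>I. f i x)"
  using assms(2)
  by (induction I rule: infinite_finite_induct) (auto simp: Cinf_on_const intro: Cinf_on_mult assms(1))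

lemma Cinf_on_component:
  "open S \<Longrightarrow> Cinf_on S f \<Longrightarrow> Cinf_on S (\<lambda>x. f x $ i)"
  by (rule Cinf_on_bounded_linear[OF _ bounded_linear_vec_nth])

lemma Cinf_on_vec_lambda:
  fixes f :: "'n::finite \<Rightarrow> 'a::real_normed_vector \<Rightarrow> real"
  assumes "open S" "\<And>i. Cinf_on S (f i)"
  shows "Cinf_on S (\<lambda>x. \<chi> i. f i x)"
proof -
  have "(\<chi> i. f i x) = (\<Sum>i\<in>UNIV. f i x *\<^sub>R axis i 1)" for x
    by (simp add: vec_eq_iff axis_def if_distrib cong: if_cong)
  then show ?thesis
    using assms by (simp add: Cinf_on_sum Cinf_on_scaleR Cinf_on_const)
qed

lemma Cinf_on_det:
  fixes f :: "'n::finite \<Rightarrow> 'n \<Rightarrow> 'a::real_normed_vector \<Rightarrow> real"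
  assumes "open S" "\<And>i j. Cinf_on S (f i j)"
  shows "Cinf_on S (\<lambda>x. det (\<chi> i j. f i j x))"
  unfolding det_def using assms
  by (auto intro!: Cinf_on_sum Cinf_on_mult Cinf_on_prod Cinf_on_const)

lemma linear_eq_sum_axis:
  fixes L :: "real^'n::finite \<Rightarrow> 'b::real_vector"
  assumes "linear L"
  shows "L w = (\<Sum>j\<in>UNIV. w $ j *\<^sub>R L (axis j 1))"
proof -
  have "w = (\<Sum>j\<in>UNIV. w $ j *\<^sub>R axis j 1)"
    by (simp add: vec_eq_iff axis_def if_distrib cong: if_cong)
  then have "L w = L (\<Sum>j\<in>UNIV. w $ j *\<^sub>R axis j 1)" by simp
  also have "\<dots> = (\<Sum>j\<in>UNIV. w $ j *\<^sub>R L (axis j 1))"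
    by (simp add: linear_sum[OF assms] linear_scale[OF assms])
  finally show ?thesis .
qed

section \<open>Symmetry of second derivatives\<close>

text \<open>The mean value theorem is applied twice: to the difference of \<open>f\<close> along two
  parallel segments in direction \<open>v\<close>, then to the derivative of \<open>f\<close> along
  \<open>v\<close> on a segment in direction \<open>w\<close>. The left-hand side is symmetric in
  \<open>v\<close> and \<open>w\<close>, while the derivative on the right is not visibly
  so.\<close>

lemma second_difference_mvt:
  fixes f :: "'a::real_normed_vector \<Rightarrow> real"
  assumes S: "open S" "Cinf_on S f" and t: "t > 0"
    and sub: "\<And>r s. 0 \<le> r \<Longrightarrow> r \<le> t \<Longrightarrow> 0 \<le> s \<Longrightarrow> s \<le> t \<Longrightarrow> x + r *\<^sub>R v + s *\<^sub>R w \<in> S"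
  shows "\<exists>r\<in>{0..t}. \<exists>s\<in>{0..t}.
    f (x + t *\<^sub>R v + t *\<^sub>R w) - f (x + t *\<^sub>R v) - f (x + t *\<^sub>R w) + f x =
    t\<^sup>2 * frechet_derivative (\<lambda>y. frechet_derivative f (at y) v) (at (x + r *\<^sub>R v + s *\<^sub>R w)) w"
proof -
  define Df where "Df y = frechet_derivative f (at y)" for y
  have *: "((\<lambda>r. f (x + r *\<^sub>R v + s *\<^sub>R w)) has_derivative (\<lambda>d. d * Df (x + r *\<^sub>R v + s *\<^sub>R w) v)) (at r within T)"
    if "0 \<le> r" "r \<le> t" "0 \<le> s" "s \<le> t" for r s T
  proof -
    have f: "(f has_derivative Df (x + r *\<^sub>R v + s *\<^sub>R w)) (at (x + r *\<^sub>R v + s *\<^sub>R w))"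
      unfolding Df_def using Cinf_on_imp_has_derivative[OF S(2,1) sub[OF that]] .
    have "((\<lambda>r. x + r *\<^sub>R v + s *\<^sub>R w) has_derivative (\<lambda>d. d *\<^sub>R v)) (at r within T)"
      by (auto intro!: derivative_eq_intros)
    from has_derivative_compose[OF this f] show ?thesis
      using linear_scale[OF has_derivative_linear[OF f]] by simp
  qed
  \<comment> \<open>The terms with \<open>0 *\<^sub>R w\<close> and \<open>t - 0\<close> are left
    unsimplified so that the claim has the literal shape of \<open>mvt_simple\<close>.\<close>
  have "\<exists>r\<in>{0<..<t}. (f (x + t *\<^sub>R v + t *\<^sub>R w) - f (x + t *\<^sub>R v + 0 *\<^sub>R w)) - (f (x + 0 *\<^sub>R v + t *\<^sub>R w) - f (x + 0 *\<^sub>R v + 0 *\<^sub>R w))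
    = (t - 0) * Df (x + r *\<^sub>R v + t *\<^sub>R w) v - (t - 0) * Df (x + r *\<^sub>R v + 0 *\<^sub>R w) v"
    using t by (intro mvt_simple[OF t, of "\<lambda>r. f (x + r *\<^sub>R v + t *\<^sub>R w) - f (x + r *\<^sub>R v + 0 *\<^sub>R w)"]
        has_derivative_diff *) auto
  then obtain r where r: "r \<in> {0<..<t}" and
    1: "f (x + t *\<^sub>R v + t *\<^sub>R w) - f (x + t *\<^sub>R v) - f (x + t *\<^sub>R w) + f x
      = t * (Df (x + r *\<^sub>R v + t *\<^sub>R w) v - Df (x + r *\<^sub>R v) v)"
    by (auto simp: algebra_simps)
  define g where "g y = Df y v" for y
  have g: "((\<lambda>s. g (x + r *\<^sub>R v + s *\<^sub>R w)) has_derivative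
      (\<lambda>d. d * frechet_derivative g (at (x + r *\<^sub>R v + s *\<^sub>R w)) w)) (at s within T)"
    if "0 \<le> s" "s \<le> t" for s T
  proof -
    have "x + r *\<^sub>R v + s *\<^sub>R w \<in> S" using r that by (intro sub) auto
    then have f: "(g has_derivative frechet_derivative g (at (x + r *\<^sub>R v + s *\<^sub>R w))) (at (x + r *\<^sub>R v + s *\<^sub>R w))"
      unfolding g_def Df_def
      by (intro Cinf_on_imp_has_derivative[OF _ S(1)] Cinf_on_derivative S)
    have "((\<lambda>s. x + r *\<^sub>R v + s *\<^sub>R w) has_derivative (\<lambda>d. d *\<^sub>R w)) (at s within T)"
      by (auto intro!: derivative_eq_intros)
    from has_derivative_compose[OF this f] show ?thesis
      using linear_scale[OF has_derivative_linear[OF f]] by simp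
  qed
  have "\<exists>s\<in>{0<..<t}. g (x + r *\<^sub>R v + t *\<^sub>R w) - g (x + r *\<^sub>R v + 0 *\<^sub>R w)
      = (t - 0) * frechet_derivative g (at (x + r *\<^sub>R v + s *\<^sub>R w)) w"
    by (intro mvt_simple[OF t, of "\<lambda>s. g (x + r *\<^sub>R v + s *\<^sub>R w)"] g) auto
  then obtain s where s: "s \<in> {0<..<t}" and
    2: "g (x + r *\<^sub>R v + t *\<^sub>R w) - g (x + r *\<^sub>R v)
      = t * frechet_derivative g (at (x + r *\<^sub>R v + s *\<^sub>R w)) w"
    by auto
  have "f (x + t *\<^sub>R v + t *\<^sub>R w) - f (x + t *\<^sub>R v) - f (x + t *\<^sub>R w) + f x
      = t\<^sup>2 * frechet_derivative g (at (x + r *\<^sub>R v + s *\<^sub>R w)) w"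
    unfolding 1 2[unfolded g_def, folded g_def[abs_def]] by (simp add: power2_eq_square)
  moreover have "r \<in> {0..t}" "s \<in> {0..t}" using r s by auto
  ultimately show ?thesis
    unfolding g_def Df_def by blast
qed

text \<open>The intermediate point of \<open>second_difference_mvt\<close> tends to \<open>x\<close>
  as \<open>t\<close> tends to 0, and the second derivative is continuous there.\<close>

lemma second_difference_tendsto:
  fixes f :: "'a::real_normed_vector \<Rightarrow> real"
  assumes S: "open S" "Cinf_on S f" "x \<in> S"
  shows "((\<lambda>t. (f (x + t *\<^sub>R v + t *\<^sub>R w) - f (x + t *\<^sub>R v) - f (x + t *\<^sub>R w) + f x) / t\<^sup>2)
    \<longlongrightarrow> frechet_derivative (\<lambda>y. frechet_derivative f (at y) v) (at x) w) (at_right 0)"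
proof -
  define g where "g y = frechet_derivative (\<lambda>y. frechet_derivative f (at y) v) (at y) w" for y
  define D where "D t = f (x + t *\<^sub>R v + t *\<^sub>R w) - f (x + t *\<^sub>R v) - f (x + t *\<^sub>R w) + f x" for t
  have "continuous (at x) g"
    using Cinf_on_imp_continuous_on[OF Cinf_on_derivative[OF Cinf_on_derivative[OF S(2)], of v w]] S
    unfolding g_def by (simp add: continuous_on_eq_continuous_at)
  have "\<exists>b>0. \<forall>t>0. t < b \<longrightarrow> dist (D t / t\<^sup>2) (g x) < e" if "e > 0" for e
  proof -
    obtain d1 where d1: "d1 > 0" "\<And>y. dist y x < d1 \<Longrightarrow> dist (g y) (g x) < e"
      using \<open>continuous (at x) g\<close> \<open>e > 0\<close> by (metis continuous_at_eps_delta)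
    obtain d2 where d2: "d2 > 0" "ball x d2 \<subseteq> S"
      using S by (meson openE)
    define d where "d = min d1 d2"
    \<comment> \<open>For r, s \<le> t < \<open>b\<close> the displacement r v + s w has norm less
      than \<open>d\<close>; the summand 1 keeps the denominator positive when \<open>v\<close> and
      \<open>w\<close> are both 0.\<close>
    define b where "b = d / (norm v + norm w + 1)"
    have d: "d > 0" using d1 d2 by (simp add: d_def)
    have n: "norm v + norm w + 1 > 0"
      by (smt (verit) norm_ge_zero)
    have b: "b > 0" using d n by (simp add: b_def)
    have near: "dist (x + r *\<^sub>R v + s *\<^sub>R w) x < d"
      if "t < b" "0 \<le> r" "r \<le> t" "0 \<le> s" "s \<le> t" for r s t
    proof -
      have "dist (x + r *\<^sub>R v + s *\<^sub>R w) x = norm (r *\<^sub>R v + s *\<^sub>R w)"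
        by (simp add: dist_norm algebra_simps)
      also have "\<dots> \<le> r * norm v + s * norm w"
        using norm_triangle_ineq[of "r *\<^sub>R v" "s *\<^sub>R w"] that by simp
      also have "\<dots> \<le> t * norm v + t * norm w"
        using that by (intro add_mono mult_right_mono) auto
      also have "\<dots> \<le> t * (norm v + norm w + 1)"
        using that by (simp add: algebra_simps)
      also have "\<dots> < b * (norm v + norm w + 1)"
        using that n by simp
      finally show ?thesis using n by (simp add: b_def)
    qed
    have "dist (D t / t\<^sup>2) (g x) < e" if t: "t > 0" "t < b" for t
    proof -
      have "\<exists>r\<in>{0..t}. \<exists>s\<in>{0..t}. D t = t\<^sup>2 * g (x + r *\<^sub>R v + s *\<^sub>R w)"
        unfolding D_def g_def
      proof (rule second_difference_mvt[OF S(1,2) t(1)])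
        show "x + r *\<^sub>R v + s *\<^sub>R w \<in> S" if "0 \<le> r" "r \<le> t" "0 \<le> s" "s \<le> t" for r s
          using near[OF t(2) that] d2 by (auto simp: d_def dist_commute)
      qed
      then obtain r s where rs: "r \<in> {0..t}" "s \<in> {0..t}" "D t = t\<^sup>2 * g (x + r *\<^sub>R v + s *\<^sub>R w)"
        by blast
      then have "dist (g (x + r *\<^sub>R v + s *\<^sub>R w)) (g x) < e"
        using near[OF t(2), of r s] d1 by (auto simp: d_def)
      then show ?thesis using rs t by simp
    qed
    then show ?thesis using b by blast
  qed
  then have "((\<lambda>t. D t / t\<^sup>2) \<longlongrightarrow> g x) (at_right 0)"
    unfolding tendsto_iff eventually_at_right_field by auto
  then show ?thesis by (simp add: D_def g_def)
qed

text \<open>Both sides are limits of the same second difference quotient, because its numerator is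
  symmetric in \<open>v\<close> and \<open>w\<close>.\<close>

lemma second_derivative_symmetric:
  fixes f :: "'a::real_normed_vector \<Rightarrow> real"
  assumes "open S" "Cinf_on S f" "x \<in> S"
  shows "frechet_derivative (\<lambda>y. frechet_derivative f (at y) v) (at x) w =
         frechet_derivative (\<lambda>y. frechet_derivative f (at y) w) (at x) v"
proof (rule tendsto_unique[OF _ second_difference_tendsto[OF assms]])
  show "((\<lambda>t. (f (x + t *\<^sub>R v + t *\<^sub>R w) - f (x + t *\<^sub>R v) - f (x + t *\<^sub>R w) + f x) / t\<^sup>2)
    \<longlongrightarrow> frechet_derivative (\<lambda>y. frechet_derivative f (at y) w) (at x) v) (at_right 0)"
    using second_difference_tendsto[OF assms, of w v] by (simp add: algebra_simps)
qed simp

section \<open>Lie derivatives and commuting frames\<close>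

text \<open>The general codomain admits a vector field \<open>W\<close> as second argument:
  \<open>lie V W\<close> differentiates the components of \<open>W\<close> along \<open>V\<close>,
  and the commutator of the two fields is the difference of \<open>lie V W\<close> and
  \<open>lie W V\<close>.\<close>

definition lie :: "('a::real_normed_vector \<Rightarrow> 'a) \<Rightarrow> ('a \<Rightarrow> 'b::real_normed_vector) \<Rightarrow> 'a \<Rightarrow> 'b" where
  "lie V f x = frechet_derivative f (at x) (V x)"

lemma lie_cong:
  "open S \<Longrightarrow> x \<in> S \<Longrightarrow> (\<And>y. y \<in> S \<Longrightarrow> f y = g y) \<Longrightarrow> lie V f x = lie V g x"
  unfolding lie_def using frechet_derivative_cong_open by metis

lemma lie_const [simp]: "lie V (\<lambda>x. c) x = 0"
  by (simp add: lie_def)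

lemma lie_diff:
  assumes "open S" "x \<in> S" "Cinf_on S f" "Cinf_on S g"
  shows "lie V (\<lambda>x. f x - g x) x = lie V f x - lie V g x"
  unfolding lie_def
  using fun_cong[OF frechet_derivative_at[OF has_derivative_diff[OF
      Cinf_on_imp_has_derivative[OF assms(3,1,2)] Cinf_on_imp_has_derivative[OF assms(4,1,2)]]]]
  by simp

lemma lie_mult:
  fixes f g :: "'a::real_normed_vector \<Rightarrow> real"
  assumes "open S" "x \<in> S" "Cinf_on S f" "Cinf_on S g"
  shows "lie V (\<lambda>x. f x * g x) x = f x * lie V g x + lie V f x * g x"
  unfolding lie_def
  using fun_cong[OF frechet_derivative_at[OF has_derivative_mult[OF
      Cinf_on_imp_has_derivative[OF assms(3,1,2)] Cinf_on_imp_has_derivative[OF assms(4,1,2)]]]]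
  by simp

lemma lie_eq_sum_axis:
  fixes f :: "real^'n::finite \<Rightarrow> 'b::real_normed_vector"
  assumes "Cinf_on S f" "open S" "x \<in> S"
  shows "lie V f x = (\<Sum>j\<in>UNIV. V x $ j *\<^sub>R frechet_derivative f (at x) (axis j 1))"
  unfolding lie_def
  by (rule linear_eq_sum_axis[OF has_derivative_linear[OF Cinf_on_imp_has_derivative[OF assms]]])

text \<open>The direction \<open>V x\<close> varies with the point, whereas
  \<open>Cinf_on_derivative\<close> has a constant direction; expanding along the axes bridges the
  gap.\<close>

lemma Cinf_on_lie:
  fixes f :: "real^'n::finite \<Rightarrow> 'b::real_normed_vector"
  assumes "open S" "Cinf_on S V" "Cinf_on S f"
  shows "Cinf_on S (lie V f)"
proof -
  have "Cinf_on S (\<lambda>x. \<Sum>j\<in>UNIV. V x $ j *\<^sub>R frechet_derivative f (at x) (axis j 1))"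
    using assms by (intro Cinf_on_sum Cinf_on_scaleR Cinf_on_component Cinf_on_derivative)
  then show ?thesis
    by (subst Cinf_on_cong[OF assms(1) lie_eq_sum_axis[OF assms(3,1)]])
qed

text \<open>Separates the first-order part, in which \<open>W\<close> is differentiated, from the
  Hessian of \<open>f\<close> applied to \<open>V\<close> and \<open>W\<close>; the latter drops out
  of commutators.\<close>

lemma lie_lie:
  fixes f :: "real^'n::finite \<Rightarrow> real"
  assumes "open S" "x \<in> S" "Cinf_on S V" "Cinf_on S W" "Cinf_on S f"
  shows "lie V (lie W f) x = frechet_derivative f (at x) (lie V W x) +
    (\<Sum>i\<in>UNIV. \<Sum>j\<in>UNIV. V x $ i * W x $ j *
      frechet_derivative (\<lambda>y. frechet_derivative f (at y) (axis j 1)) (at x) (axis i 1))"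
proof -
  let ?D = "\<lambda>j x. frechet_derivative f (at x) (axis j 1)"
  have W: "(W has_derivative frechet_derivative W (at x)) (at x)"
    by (rule Cinf_on_imp_has_derivative[OF assms(4,1,2)])
  have D: "(?D j has_derivative frechet_derivative (?D j) (at x)) (at x)" for j
    by (rule Cinf_on_imp_has_derivative[OF Cinf_on_derivative[OF assms(5)] assms(1,2)])
  have "((\<lambda>x. \<Sum>j\<in>UNIV. W x $ j * ?D j x) has_derivative
     (\<lambda>v. \<Sum>j\<in>UNIV. W x $ j * frechet_derivative (?D j) (at x) v + frechet_derivative W (at x) v $ j * ?D j x)) (at x)"
    by (intro has_derivative_sum has_derivative_mult D
        bounded_linear.has_derivative[OF bounded_linear_vec_nth W])
  from fun_cong[OF frechet_derivative_at[OF this], of "V x"]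
  have "lie V (\<lambda>x. \<Sum>j\<in>UNIV. W x $ j * ?D j x) x =
     (\<Sum>j\<in>UNIV. W x $ j * frechet_derivative (?D j) (at x) (V x) + lie V W x $ j * ?D j x)"
    unfolding lie_def by simp
  also have "\<dots> = (\<Sum>j\<in>UNIV. \<Sum>i\<in>UNIV. V x $ i * W x $ j * frechet_derivative (?D j) (at x) (axis i 1))
      + (\<Sum>j\<in>UNIV. lie V W x $ j * ?D j x)"
    using linear_eq_sum_axis[OF has_derivative_linear[OF D], of _ "V x"]
    by (simp add: sum.distrib sum_distrib_left mult.assoc mult.left_commute)
  also have "(\<Sum>j\<in>UNIV. lie V W x $ j * ?D j x) = frechet_derivative f (at x) (lie V W x)"
    using linear_eq_sum_axis[OF has_derivative_linear[OF Cinf_on_imp_has_derivative[OF assms(5,1,2)]],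
        of "lie V W x"]
    by simp
  also have "lie V (\<lambda>x. \<Sum>j\<in>UNIV. W x $ j * ?D j x) x = lie V (lie W f) x"
    using lie_eq_sum_axis[OF assms(5,1), of _ W] by (intro lie_cong[OF assms(1,2)]) simp
  finally show ?thesis
    by (subst sum.swap) simp
qed

text \<open>The Hessian parts of the two iterated derivatives agree by symmetry, so the commutator
  is again a first-order operator.\<close>

lemma lie_commutator:
  fixes f :: "real^'n::finite \<Rightarrow> real"
  assumes "open S" "x \<in> S" "Cinf_on S V" "Cinf_on S W" "Cinf_on S f"
  shows "lie V (lie W f) x - lie W (lie V f) x =
    frechet_derivative f (at x) (lie V W x - lie W V x)"
proof -
  let ?D = "\<lambda>i j. frechet_derivative (\<lambda>y. frechet_derivative f (at y) (axis j 1)) (at x) (axis i 1)"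
  have "(\<Sum>i\<in>UNIV. \<Sum>j\<in>UNIV. V x $ i * W x $ j * ?D i j) =
        (\<Sum>j\<in>UNIV. \<Sum>i\<in>UNIV. V x $ i * W x $ j * ?D i j)"
    by (rule sum.swap)
  also have "\<dots> = (\<Sum>j\<in>UNIV. \<Sum>i\<in>UNIV. W x $ j * V x $ i * ?D j i)"
    using second_derivative_symmetric[OF assms(1,5,2)] by (simp add: mult.commute)
  finally show ?thesis
    using lie_lie[OF assms] lie_lie[OF assms(1,2,4,3,5)]
      linear_diff[OF has_derivative_linear[OF Cinf_on_imp_has_derivative[OF assms(5,1,2)]],
        of "lie V W x" "lie W V x"]
    by simp
qed

text \<open>The functions \<open>G k\<close> are local coordinates, up to the inverse function theorem, and
  \<open>E k\<close> below are the coordinate vector fields.\<close>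

locale coordinate_functions =
  fixes S :: "(real^'n::finite) set" and G :: "'n \<Rightarrow> real^'n \<Rightarrow> real"
  assumes open_S: "open S" and smooth_G: "Cinf_on S (G k)"
    and det_nz: "x \<in> S \<Longrightarrow> det (\<chi> a b. frechet_derivative (G a) (at x) (axis b 1)) \<noteq> 0"
begin

definition Jac :: "real^'n \<Rightarrow> real^'n^'n" where
  "Jac x = (\<chi> a b. frechet_derivative (G a) (at x) (axis b 1))"

text \<open>Cramer's formula for the solution of \<open>Jac x *v w = axis k 1\<close>, that is,
  column \<open>k\<close> of the inverse Jacobian. Being an explicit quotient of determinants, it is
  smooth.\<close>

definition E :: "'n \<Rightarrow> real^'n \<Rightarrow> real^'n" where
  "E k x = (\<chi> c. det (\<chi> a b. if b = c then axis k 1 $ a else Jac x $ a $ b) / det (Jac x))"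

lemma det_Jac: "x \<in> S \<Longrightarrow> det (Jac x) \<noteq> 0"
  using det_nz by (simp add: Jac_def)

lemma Jac_mult: "x \<in> S \<Longrightarrow> (Jac x *v w) $ k = frechet_derivative (G k) (at x) w"
  using linear_eq_sum_axis[OF has_derivative_linear[OF
      Cinf_on_imp_has_derivative[OF smooth_G[of k] open_S]], of x w]
  by (simp add: Jac_def matrix_vector_mult_def mult.commute)

lemma smooth_E: "Cinf_on S (E k)"
proof -
  have J: "Cinf_on S (\<lambda>x. frechet_derivative (G a) (at x) (axis b 1))" for a b
    by (rule Cinf_on_derivative[OF smooth_G])
  have "Cinf_on S (\<lambda>x. if b = c then axis k 1 $ a else frechet_derivative (G a) (at x) (axis b 1))" for a b c
    using J Cinf_on_const by (cases "b = c") auto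
  then show ?thesis
    unfolding E_def[abs_def] Jac_def using det_nz J
    by (intro Cinf_on_vec_lambda[OF open_S] Cinf_on_divide[OF open_S])
      (simp_all add: Cinf_on_det[OF open_S] cong del: if_weak_cong)
qed

lemma derivative_G_E:
  assumes "x \<in> S"
  shows "frechet_derivative (G j) (at x) (E k x) = (if j = k then 1 else 0)"
proof -
  have "Jac x *v E k x = axis k 1"
    using cramer[OF det_Jac[OF assms]] by (simp add: E_def)
  then show ?thesis
    using Jac_mult[OF assms, of "E k x" j] by (simp add: axis_def)
qed

text \<open>The rows of the invertible matrix \<open>Jac x\<close> are the differentials of the
  \<open>G k\<close>. Identities between vectors can therefore be verified by applying all these
  differentials.\<close>

lemma eq_zero_if_derivatives_zero:
  assumes "x \<in> S" "\<And>k. frechet_derivative (G k) (at x) w = 0"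
  shows "w = 0"
proof -
  have "Jac x *v w = 0"
    by (simp add: vec_eq_iff Jac_mult assms)
  moreover have "inj ((*v) (Jac x))"
    using det_Jac[OF assms(1)] by (simp add: invertible_det_nz inj_matrix_vector_mult)
  ultimately show ?thesis
    using injD[of "(*v) (Jac x)" w 0] by simp
qed

lemma eq_sum_E:
  assumes "x \<in> S"
  shows "w = (\<Sum>k\<in>UNIV. frechet_derivative (G k) (at x) w *\<^sub>R E k x)"
proof -
  have lin: "linear (frechet_derivative (G j) (at x))" for j
    by (rule has_derivative_linear[OF Cinf_on_imp_has_derivative[OF smooth_G open_S assms]])
  have "w - (\<Sum>k\<in>UNIV. frechet_derivative (G k) (at x) w *\<^sub>R E k x) = 0"
    by (rule eq_zero_if_derivatives_zero[OF assms])
      (simp add: linear_diff[OF lin] linear_sum[OF lin] linear_scale[OF lin] derivative_G_E[OF assms]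
        if_distrib cong: if_cong)
  then show ?thesis by simp
qed

lemma lie_E_commute:
  fixes f :: "real^'n \<Rightarrow> real"
  assumes "x \<in> S" "Cinf_on S f"
  shows "lie (E i) (lie (E j) f) x = lie (E j) (lie (E i) f) x"
proof -
  have "lie (E i) (E j) x - lie (E j) (E i) x = 0"
  proof (rule eq_zero_if_derivatives_zero[OF assms(1)])
    fix k
    \<comment> \<open>\<open>E j\<close> applied to \<open>G k\<close> is a Kronecker delta, hence
      constant on \<open>S\<close>, and one more derivative kills it.\<close>
    have *: "lie (E i) (lie (E j) (G k)) x = 0" for i j
    proof -
      have "lie (E i) (lie (E j) (G k)) x = lie (E i) (\<lambda>x. if k = j then 1 else 0) x"
        by (rule lie_cong[OF open_S assms(1)]) (simp add: lie_def derivative_G_E)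
      then show ?thesis by simp
    qed
    show "frechet_derivative (G k) (at x) (lie (E i) (E j) x - lie (E j) (E i) x) = 0"
      using lie_commutator[OF open_S assms(1) smooth_E[of i] smooth_E[of j] smooth_G[of k]] * by simp
  qed
  then show ?thesis
    using lie_commutator[OF open_S assms(1) smooth_E[of i] smooth_E[of j] assms(2)]
      linear_0[OF has_derivative_linear[OF Cinf_on_imp_has_derivative[OF assms(2) open_S assms(1)]]]
    by simp
qed

text \<open>The function bracket of the bivector \<open>E i\<close> wedge u \<open>E l\<close>, with
  the sign convention pi(df, dg) = df(Y) dg(X) - df(X) dg(Y) for Y = \<open>E i\<close> and X = u
  \<open>E l\<close>. The index \<open>l\<close> marks the factor shared by all these
  bivectors.\<close>

definition bracket ::
  "(real^'n \<Rightarrow> real) \<Rightarrow> 'n \<Rightarrow> 'n \<Rightarrow> (real^'n \<Rightarrow> real) \<Rightarrow> (real^'n \<Rightarrow> real) \<Rightarrow> real^'n \<Rightarrow> real" where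
  "bracket u l i f g x =
     u x * (lie (E i) f x * lie (E l) g x - lie (E l) f x * lie (E i) g x)"

text \<open>The Leibniz rule, expanded completely, so that nested brackets become polynomials in
  frame derivatives of order at most two.\<close>

lemma lie_bracket:
  assumes x: "x \<in> S" and u: "Cinf_on S u" and f: "Cinf_on S f" and g: "Cinf_on S g"
  shows "lie (E k) (bracket u l i f g) x =
    u x * (lie (E i) f x * lie (E k) (lie (E l) g) x + lie (E k) (lie (E i) f) x * lie (E l) g x
        - (lie (E l) f x * lie (E k) (lie (E i) g) x + lie (E k) (lie (E l) f) x * lie (E i) g x))
    + lie (E k) u x * (lie (E i) f x * lie (E l) g x - lie (E l) f x * lie (E i) g x)"
proof -
  have s: "Cinf_on S (lie (E k) f)" "Cinf_on S (lie (E k) g)" for k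
    using f g by (auto intro!: Cinf_on_lie open_S smooth_E)
  have p: "Cinf_on S (\<lambda>x. lie (E i) f x * lie (E l) g x)"
    "Cinf_on S (\<lambda>x. lie (E l) f x * lie (E i) g x)"
    using s by (auto intro!: Cinf_on_mult open_S)
  show ?thesis
    unfolding bracket_def[abs_def] lie_mult[OF open_S x u Cinf_on_diff[OF open_S p]]
      lie_diff[OF open_S x p] lie_mult[OF open_S x s(1) s(2)]
    by simp
qed

text \<open>Write f_i for the derivative of \<open>f\<close> along \<open>E i\<close>. In the first
  group, the terms with u_j form a determinant whose \<open>l\<close>-column occurs twice. The terms
  with u_l form the determinant of f, g, h along i, l, j, which changes sign when \<open>i\<close>
  and \<open>j\<close> are exchanged; so do the second-order terms that survive within a group, once
  derivatives commute. The symmetrised sum is therefore essential: for distinct indices one group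
  alone need not vanish.\<close>

lemma bracket_jacobiator:
  assumes x: "x \<in> S" and u: "Cinf_on S u"
    and f: "Cinf_on S f" and g: "Cinf_on S g" and h: "Cinf_on S h"
  shows "(bracket u l j (bracket u l i f g) h x - bracket u l j (bracket u l i f h) g x
        + bracket u l j (bracket u l i g h) f x)
      + (bracket u l i (bracket u l j f g) h x - bracket u l i (bracket u l j f h) g x
        + bracket u l i (bracket u l j g h) f x) = 0"
proof -
  \<comment> \<open>Each mixed derivative is given a single spelling; what remains is a polynomial
    identity.\<close>
  have c: "lie (E j) (lie (E i) f) x = lie (E i) (lie (E j) f) x"
    "lie (E l) (lie (E i) f) x = lie (E i) (lie (E l) f) x"
    "lie (E l) (lie (E j) f) x = lie (E j) (lie (E l) f) x" if "Cinf_on S f" for f :: "real^'n \<Rightarrow> real"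
    using lie_E_commute[OF x that] by auto
  show ?thesis
    unfolding bracket_def[of u l _ "bracket _ _ _ _ _"] lie_bracket[OF x u f g] lie_bracket[OF x u f h]
      lie_bracket[OF x u g h] c[OF f] c[OF g] c[OF h]
    by algebra
qed

end

section \<open>Tangent and cotangent vectors in charts\<close>

lemma sum_fun_eval: "(\<Sum>i\<in>I. f i) x = (\<Sum>i\<in>I. (f i x :: 'b::comm_monoid_add))"
  by (induction I rule: infinite_finite_induct) auto

lemma scaleR_fun_eval: "(r *\<^sub>R f) x = r *\<^sub>R (f x :: 'b::real_vector)"
  by (simp add: scaleR_fun_def)

locale manifold =
  fixes M :: "'a topology" and A :: "('a, 'n::finite) chart set"
  assumes manifold: "smooth_manifold M A"
begin

abbreviation tangent_map :: "('a, 'n) chart \<Rightarrow> ('a, 'n) chart \<Rightarrow> 'a \<Rightarrow> real^'n \<Rightarrow> real^'n" where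
  "tangent_map c d x \<equiv> frechet_derivative (transition c d) (at (snd c x))"

lemma is_chart: "c \<in> A \<Longrightarrow> is_chart M c"
  using manifold by (simp add: smooth_manifold_def)

lemma openin_chart: "c \<in> A \<Longrightarrow> openin M (fst c)"
  using is_chart by (auto simp: is_chart_def)

lemma Union_charts: "\<Union> (fst ` A) = topspace M"
  using manifold by (simp add: smooth_manifold_def)

lemma ex_chart: "x \<in> topspace M \<Longrightarrow> \<exists>c\<in>A. x \<in> fst c"
  unfolding Union_charts[symmetric] by blast

lemma inj_on_chart: "c \<in> A \<Longrightarrow> inj_on (snd c) (fst c)"
  using is_chart[of c] openin_subset[OF openin_chart, of c]
  by (auto simp: is_chart_def homeomorphic_map_def inj_on_def)

lemma chart_inv_chart [simp]: "c \<in> A \<Longrightarrow> x \<in> fst c \<Longrightarrow> chart_inv c (snd c x) = x"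
  by (simp add: chart_inv_def inj_on_chart)

lemma transition_chart [simp]: "c \<in> A \<Longrightarrow> x \<in> fst c \<Longrightarrow> transition c d (snd c x) = snd d x"
  by (simp add: transition_def)

lemma open_image_chart:
  assumes "c \<in> A" "openin M V"
  shows "open (snd c ` (fst c \<inter> V))"
proof -
  have "openin (subtopology M (fst c)) (fst c \<inter> V)"
    using assms(2) by (simp add: openin_subtopology_Int2)
  then have "openin (top_of_set (snd c ` fst c)) (snd c ` (fst c \<inter> V))"
    using is_chart[OF assms(1)] homeomorphic_imp_open_map
    unfolding is_chart_def open_map_def by blast
  moreover have "open (snd c ` fst c)"
    using is_chart[OF assms(1)] by (simp add: is_chart_def)
  ultimately show ?thesis
    by (metis openin_open_eq)
qed

lemma smooth_transition:
  "c \<in> A \<Longrightarrow> d \<in> A \<Longrightarrow> Cinf_on (snd c ` (fst c \<inter> fst d)) (transition c d)"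
  using manifold by (auto simp: smooth_manifold_def compatible_def)

lemma has_derivative_transition:
  assumes "c \<in> A" "d \<in> A" "x \<in> fst c \<inter> fst d"
  shows "(transition c d has_derivative tangent_map c d x) (at (snd c x))"
  by (rule Cinf_on_imp_has_derivative[OF smooth_transition open_image_chart[OF _ openin_chart]])
    (use assms in auto)

lemma linear_tangent_map:
  "c \<in> A \<Longrightarrow> d \<in> A \<Longrightarrow> x \<in> fst c \<inter> fst d \<Longrightarrow> linear (tangent_map c d x)"
  using has_derivative_linear[OF has_derivative_transition] .

lemma tangent_map_id:
  assumes "c \<in> A" "x \<in> fst c"
  shows "tangent_map c c x w = w"
proof -
  have "tangent_map c c x = frechet_derivative (\<lambda>p. p) (at (snd c x))"
    by (rule frechet_derivative_cong_open[OF open_image_chart[OF assms(1) openin_chart[OF assms(1)]]])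
      (use assms in auto)
  then show ?thesis by simp
qed

text \<open>The chain rule on the triple overlap, where the composed transition maps agree with the
  direct one. It is the reason why \<open>lift\<close> produces tangent vectors.\<close>

lemma tangent_map_comp:
  assumes "c \<in> A" "d \<in> A" "e \<in> A" "x \<in> fst c" "x \<in> fst d" "x \<in> fst e"
  shows "tangent_map d e x (tangent_map c d x w) = tangent_map c e x w"
proof -
  have 1: "((\<lambda>p. transition d e (transition c d p)) has_derivative
      (\<lambda>w. tangent_map d e x (tangent_map c d x w))) (at (snd c x))"
    using has_derivative_transition[of d e x] assms
    by (intro has_derivative_compose[OF has_derivative_transition[of c d x]]) simp_all
  have 2: "frechet_derivative (\<lambda>p. transition d e (transition c d p)) (at (snd c x)) =
      tangent_map c e x"
    by (rule frechet_derivative_cong_open[OF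
          open_image_chart[OF assms(1) openin_Int[OF openin_chart[OF assms(2)] openin_chart[OF assms(3)]]]])
      (use assms in auto)
  show ?thesis
    using fun_cong[OF frechet_derivative_at[OF 1], of w] unfolding 2 .
qed

lemma tangent_space_transition:
  "v \<in> tangent_space A x \<Longrightarrow> c \<in> A \<Longrightarrow> d \<in> A \<Longrightarrow> x \<in> fst c \<Longrightarrow> x \<in> fst d \<Longrightarrow>
    v d = tangent_map c d x (v c)"
  unfolding tangent_space_def by blast

lemma tangent_space_outside:
  "v \<in> tangent_space A x \<Longrightarrow> \<not> (c \<in> A \<and> x \<in> fst c) \<Longrightarrow> v c = 0"
  unfolding tangent_space_def by blast

lemma tangent_spaceI:
  assumes "\<And>c. \<not> (c \<in> A \<and> x \<in> fst c) \<Longrightarrow> v c = 0"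
    and "\<And>c d. c \<in> A \<Longrightarrow> d \<in> A \<Longrightarrow> x \<in> fst c \<Longrightarrow> x \<in> fst d \<Longrightarrow> v d = tangent_map c d x (v c)"
  shows "v \<in> tangent_space A x"
  unfolding tangent_space_def using assms by blast

text \<open>The inverse of the evaluation of tangent vectors in the chart \<open>c\<close>. The
  value 0 at charts that do not contain \<open>x\<close> is the one that
  \<open>tangent_space\<close> demands.\<close>

definition lift :: "('a, 'n) chart \<Rightarrow> 'a \<Rightarrow> real^'n \<Rightarrow> ('a, 'n) tangent" where
  "lift c x w = (\<lambda>d. if d \<in> A \<and> x \<in> fst d then tangent_map c d x w else 0)"

lemma lift_in_tangent_space:
  "c \<in> A \<Longrightarrow> x \<in> fst c \<Longrightarrow> lift c x w \<in> tangent_space A x"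
  by (rule tangent_spaceI) (auto simp: lift_def tangent_map_comp)

lemma lift_apply [simp]: "c \<in> A \<Longrightarrow> x \<in> fst c \<Longrightarrow> lift c x w c = w"
  by (simp add: lift_def tangent_map_id)

lemma tangent_eqI:
  assumes "v \<in> tangent_space A x" "w \<in> tangent_space A x" "c \<in> A" "x \<in> fst c" "v c = w c"
  shows "v = w"
proof
  fix d
  show "v d = w d"
  proof (cases "d \<in> A \<and> x \<in> fst d")
    case True
    then show ?thesis
      using tangent_space_transition[OF assms(1,3) _ assms(4), of d]
        tangent_space_transition[OF assms(2,3) _ assms(4), of d] assms(5) by simp
  next
    case False
    then show ?thesis
      using tangent_space_outside[OF assms(1) False] tangent_space_outside[OF assms(2) False] by simp
  qed
qed

lemma lift_tangent:
  "v \<in> tangent_space A x \<Longrightarrow> c \<in> A \<Longrightarrow> x \<in> fst c \<Longrightarrow> lift c x (v c) = v"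
  by (rule tangent_eqI[OF lift_in_tangent_space]) auto

lemma tangent_space_add:
  assumes "v \<in> tangent_space A x" "w \<in> tangent_space A x"
  shows "v + w \<in> tangent_space A x"
proof (rule tangent_spaceI)
  show "(v + w) d = tangent_map c d x ((v + w) c)"
    if "c \<in> A" "d \<in> A" "x \<in> fst c" "x \<in> fst d" for c d
    using tangent_space_transition[OF assms(1) that] tangent_space_transition[OF assms(2) that] that
    by (simp add: linear_add[OF linear_tangent_map])
qed (use assms in \<open>simp add: tangent_space_outside scaleR_fun_eval\<close>)

lemma tangent_space_scaleR:
  assumes "v \<in> tangent_space A x"
  shows "r *\<^sub>R v \<in> tangent_space A x"
proof (rule tangent_spaceI)
  show "(r *\<^sub>R v) d = tangent_map c d x ((r *\<^sub>R v) c)"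
    if "c \<in> A" "d \<in> A" "x \<in> fst c" "x \<in> fst d" for c d
    using tangent_space_transition[OF assms(1) that] that
    by (simp add: scaleR_fun_eval linear_scale[OF linear_tangent_map])
qed (use assms in \<open>simp add: tangent_space_outside scaleR_fun_eval\<close>)

lemma tangent_space_diff:
  "v \<in> tangent_space A x \<Longrightarrow> w \<in> tangent_space A x \<Longrightarrow> v - w \<in> tangent_space A x"
  using tangent_space_add[of v x "(-1) *\<^sub>R w"] tangent_space_scaleR[of w x "-1"] by simp

lemma cotangent_add:
  "\<alpha> \<in> cotangent_space A x \<Longrightarrow> v \<in> tangent_space A x \<Longrightarrow> w \<in> tangent_space A x \<Longrightarrow>
    \<alpha> (v + w) = \<alpha> v + \<alpha> w"
  by (simp add: cotangent_space_def)

lemma cotangent_scaleR: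
  "\<alpha> \<in> cotangent_space A x \<Longrightarrow> v \<in> tangent_space A x \<Longrightarrow> \<alpha> (r *\<^sub>R v) = r * \<alpha> v"
  by (simp add: cotangent_space_def)

lemma cotangent_diff:
  "\<alpha> \<in> cotangent_space A x \<Longrightarrow> v \<in> tangent_space A x \<Longrightarrow> w \<in> tangent_space A x \<Longrightarrow>
    \<alpha> (v - w) = \<alpha> v - \<alpha> w"
  using cotangent_add[of \<alpha> x v "(-1) *\<^sub>R w"] cotangent_scaleR[of \<alpha> x w "-1"]
    tangent_space_scaleR[of w x "-1"] by simp

lemma cotangent_space_lincomb:
  "\<alpha> \<in> cotangent_space A x \<Longrightarrow> \<beta> \<in> cotangent_space A x \<Longrightarrow>
    r *\<^sub>R \<alpha> + s *\<^sub>R \<beta> \<in> cotangent_space A x"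
  by (auto simp: cotangent_space_def scaleR_fun_eval algebra_simps)

lemma cotangent_space_zero: "0 \<in> cotangent_space A x"
  by (simp add: cotangent_space_def)

lemma cotangent_space_sum:
  assumes "\<And>k. k \<in> I \<Longrightarrow> \<theta> k \<in> cotangent_space A x"
  shows "(\<Sum>k\<in>I. r k *\<^sub>R \<theta> k) \<in> cotangent_space A x"
  using assms
proof (induction I rule: infinite_finite_induct)
  case (insert k I)
  then have "r k *\<^sub>R \<theta> k + 1 *\<^sub>R (\<Sum>k\<in>I. r k *\<^sub>R \<theta> k) \<in> cotangent_space A x"
    by (intro cotangent_space_lincomb) blast+
  then show ?case
    unfolding sum.insert[OF insert.hyps(1,2)] scaleR_one .
qed (auto simp: cotangent_space_zero)

text \<open>The counterpart of \<open>lift\<close>: a linear form in the coordinates of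
  \<open>c\<close> is turned into a cotangent vector, and every cotangent vector at \<open>x\<close>
  arises in this way.\<close>

definition covector :: "('a, 'n) chart \<Rightarrow> 'a \<Rightarrow> (real^'n \<Rightarrow> real) \<Rightarrow> ('a, 'n) cotangent" where
  "covector c x L v = (if v \<in> tangent_space A x then L (v c) else 0)"

lemma covector_in_cotangent_space:
  "linear L \<Longrightarrow> covector c x L \<in> cotangent_space A x"
  by (auto simp: cotangent_space_def covector_def tangent_space_add tangent_space_scaleR scaleR_fun_eval
      linear_add linear_scale)

lemma linear_cotangent_lift:
  assumes "\<alpha> \<in> cotangent_space A x" "c \<in> A" "x \<in> fst c"
  shows "linear (\<lambda>w. \<alpha> (lift c x w))"
proof (rule linearI)
  have "lift c x (v + w) = lift c x v + lift c x w" for v w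
    by (rule tangent_eqI[OF _ _ assms(2,3)])
      (simp_all add: assms lift_in_tangent_space tangent_space_add)
  then show "\<alpha> (lift c x (v + w)) = \<alpha> (lift c x v) + \<alpha> (lift c x w)" for v w
    using assms lift_in_tangent_space cotangent_add by metis
  have "lift c x (r *\<^sub>R w) = r *\<^sub>R lift c x w" for r w
    by (rule tangent_eqI[OF _ _ assms(2,3)])
      (simp_all add: assms lift_in_tangent_space tangent_space_scaleR scaleR_fun_eval)
  then show "\<alpha> (lift c x (r *\<^sub>R w)) = r *\<^sub>R \<alpha> (lift c x w)" for r w
    using assms lift_in_tangent_space cotangent_scaleR by simp
qed

lemma covector_cotangent:
  "\<alpha> \<in> cotangent_space A x \<Longrightarrow> c \<in> A \<Longrightarrow> x \<in> fst c \<Longrightarrow>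
    covector c x (\<lambda>w. \<alpha> (lift c x w)) = \<alpha>"
  by (auto simp: covector_def fun_eq_iff lift_tangent cotangent_space_def)

section \<open>Differentials in charts\<close>

lemma smooth_map_onD:
  "smooth_map_on A V f \<Longrightarrow> c \<in> A \<Longrightarrow> Cinf_on (snd c ` (fst c \<inter> V)) (f \<circ> chart_inv c)"
  by (simp add: smooth_map_on_def)

lemma smooth_map_on_subset: "smooth_map_on A V f \<Longrightarrow> W \<subseteq> V \<Longrightarrow> smooth_map_on A W f"
  unfolding smooth_map_on_def by (meson Cinf_on_subset image_mono Int_mono subset_refl)

text \<open>\<open>differential\<close> uses a chart picked by \<open>SOME\<close>; the chain rule
  for the transition map allows any other chart around \<open>x\<close> in its place.\<close>

lemma differential_eq_covector:
  assumes "openin M V" "x \<in> V" "smooth_map_on A V f" "c \<in> A" "x \<in> fst c"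
  shows "differential A f x = covector c x (frechet_derivative (f \<circ> chart_inv c) (at (snd c x)))"
proof
  fix v
  define d where "d = (SOME d. d \<in> A \<and> x \<in> fst d)"
  have d: "d \<in> A" "x \<in> fst d"
    unfolding d_def using someI[of "\<lambda>d. d \<in> A \<and> x \<in> fst d" c] assms by auto
  have D: "(f \<circ> chart_inv e has_derivative frechet_derivative (f \<circ> chart_inv e) (at (snd e x))) (at (snd e x))"
    if "e \<in> A" "x \<in> fst e" for e
    by (rule Cinf_on_imp_has_derivative[OF smooth_map_onD[OF assms(3) that(1)]
          open_image_chart[OF that(1) assms(1)]])
      (use that assms in auto)
  have "((\<lambda>p. (f \<circ> chart_inv c) (transition d c p)) has_derivative
    (\<lambda>w. frechet_derivative (f \<circ> chart_inv c) (at (snd c x)) (tangent_map d c x w))) (at (snd d x))"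
    by (rule has_derivative_compose[OF has_derivative_transition])
      (use D[OF assms(4,5)] d assms in \<open>simp_all only: transition_chart Int_iff\<close>)
  moreover have "frechet_derivative (\<lambda>p. (f \<circ> chart_inv c) (transition d c p)) (at (snd d x)) =
      frechet_derivative (f \<circ> chart_inv d) (at (snd d x))"
    by (rule frechet_derivative_cong_open[OF
          open_image_chart[OF d(1) openin_chart[OF assms(4)]]])
      (use d assms in auto)
  ultimately have *: "frechet_derivative (f \<circ> chart_inv d) (at (snd d x)) =
      (\<lambda>w. frechet_derivative (f \<circ> chart_inv c) (at (snd c x)) (tangent_map d c x w))"
    using frechet_derivative_at[of "\<lambda>p. (f \<circ> chart_inv c) (transition d c p)"] by simp
  show "differential A f x v = covector c x (frechet_derivative (f \<circ> chart_inv c) (at (snd c x))) v"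
    using tangent_space_transition[of v x d c] d assms
    by (auto simp: differential_def covector_def Let_def * simp flip: d_def)
qed

lemma differential_in_cotangent_space:
  assumes "openin M V" "x \<in> V" "smooth_map_on A V f"
  shows "differential A f x \<in> cotangent_space A x"
proof -
  obtain c where c: "c \<in> A" "x \<in> fst c"
    using assms ex_chart openin_subset by blast
  have "linear (frechet_derivative (f \<circ> chart_inv c) (at (snd c x)))"
    by (rule has_derivative_linear[OF Cinf_on_imp_has_derivative[OF smooth_map_onD[OF assms(3) c(1)]
          open_image_chart[OF c(1) assms(1)]]])
      (use c assms in auto)
  then show ?thesis
    using differential_eq_covector[OF assms c] covector_in_cotangent_space by metis
qed

text \<open>A linear form composed with the chart map has the required differential. Such functions
  keep the description that defines \<open>schouten\<close> from being vacuous.\<close>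

lemma ex_function_with_differential:
  assumes "\<alpha> \<in> cotangent_space A x" "x \<in> topspace M"
  shows "\<exists>f V. openin M V \<and> x \<in> V \<and> smooth_map_on A V f \<and> differential A f x = \<alpha>"
proof -
  obtain c where c: "c \<in> A" "x \<in> fst c"
    using assms ex_chart by blast
  define L where "L w = \<alpha> (lift c x w)" for w
  have L: "bounded_linear L"
    unfolding L_def[abs_def] using linear_cotangent_lift[OF assms(1) c]
    by (simp add: linear_conv_bounded_linear)
  have eq: "L (transition d c p) = (L \<circ> snd c \<circ> chart_inv d) p" for d p
    by (simp add: transition_def)
  have smooth: "smooth_map_on A (fst c) (L \<circ> snd c)"
    unfolding smooth_map_on_def
  proof
    fix d assume d: "d \<in> A"
    have "Cinf_on (snd d ` (fst d \<inter> fst c)) (\<lambda>p. L (transition d c p))"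
      by (rule Cinf_on_bounded_linear[OF open_image_chart[OF d openin_chart[OF c(1)]] L
            smooth_transition[OF d c(1)]])
    then show "Cinf_on (snd d ` (fst d \<inter> fst c)) (L \<circ> snd c \<circ> chart_inv d)"
      by (simp add: eq o_def)
  qed
  have "frechet_derivative (L \<circ> snd c \<circ> chart_inv c) (at (snd c x)) = frechet_derivative L (at (snd c x))"
    by (rule frechet_derivative_cong_open[OF open_image_chart[OF c(1) openin_chart[OF c(1)]]])
      (use c in auto)
  also have "\<dots> = L"
    by (rule frechet_derivative_at[OF bounded_linear_imp_has_derivative[OF L], symmetric])
  finally have "differential A (L \<circ> snd c) x = \<alpha>"
    using differential_eq_covector[OF openin_chart[OF c(1)] c(2) smooth c]
      covector_cotangent[OF assms(1) c] by (simp add: L_def[abs_def])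
  then show ?thesis
    using smooth openin_chart[OF c(1)] c(2) by blast
qed

section \<open>Bivectors\<close>

lemma multivector_outside:
  "P \<in> multivectors A k x \<Longrightarrow> \<not> (length \<alpha>s = k \<and> set \<alpha>s \<subseteq> cotangent_space A x) \<Longrightarrow> P \<alpha>s = 0"
  unfolding multivectors_def mem_Collect_eq by (drule conjunct1) blast

lemma bivector_linear_right:
  assumes "P \<in> multivectors A 2 x" "\<alpha> \<in> cotangent_space A x" "\<beta> \<in> cotangent_space A x"
    "\<gamma> \<in> cotangent_space A x"
  shows "P [\<alpha>, r *\<^sub>R \<beta> + s *\<^sub>R \<gamma>] = r * P [\<alpha>, \<beta>] + s * P [\<alpha>, \<gamma>]"
proof -
  have "length [\<alpha>, \<beta>] = 2 \<and> set [\<alpha>, \<beta>] \<subseteq> cotangent_space A x \<and> (1::nat) < 2"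
    using assms by simp
  then have "P ([\<alpha>, \<beta>][1 := r *\<^sub>R \<beta> + s *\<^sub>R \<gamma>]) = r * P ([\<alpha>, \<beta>][1 := \<beta>]) + s * P ([\<alpha>, \<beta>][1 := \<gamma>])"
    using assms unfolding multivectors_def by blast
  then show ?thesis by simp
qed

lemma bivector_linear_left:
  assumes "P \<in> multivectors A 2 x" "\<alpha> \<in> cotangent_space A x" "\<beta> \<in> cotangent_space A x"
    "\<gamma> \<in> cotangent_space A x"
  shows "P [r *\<^sub>R \<beta> + s *\<^sub>R \<gamma>, \<alpha>] = r * P [\<beta>, \<alpha>] + s * P [\<gamma>, \<alpha>]"
proof -
  have "length [\<beta>, \<alpha>] = 2 \<and> set [\<beta>, \<alpha>] \<subseteq> cotangent_space A x \<and> (0::nat) < 2"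
    using assms by simp
  then have "P ([\<beta>, \<alpha>][0 := r *\<^sub>R \<beta> + s *\<^sub>R \<gamma>]) = r * P ([\<beta>, \<alpha>][0 := \<beta>]) + s * P ([\<beta>, \<alpha>][0 := \<gamma>])"
    using assms unfolding multivectors_def by blast
  then show ?thesis by simp
qed

lemma bivector_diag:
  assumes "P \<in> multivectors A 2 x" "\<alpha> \<in> cotangent_space A x"
  shows "P [\<alpha>, \<alpha>] = 0"
proof -
  have "length [\<alpha>, \<alpha>] = 2 \<and> set [\<alpha>, \<alpha>] \<subseteq> cotangent_space A x \<and> (0::nat) < 1 \<and> 1 < (2::nat) \<and>
      [\<alpha>, \<alpha>] ! 0 = [\<alpha>, \<alpha>] ! 1"
    using assms by simp
  then show ?thesis
    using assms unfolding multivectors_def by blast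
qed

lemma bivector_antisym:
  assumes "P \<in> multivectors A 2 x" "\<alpha> \<in> cotangent_space A x" "\<beta> \<in> cotangent_space A x"
  shows "P [\<alpha>, \<beta>] = - P [\<beta>, \<alpha>]"
proof -
  have "P [1 *\<^sub>R \<alpha> + 1 *\<^sub>R \<beta>, 1 *\<^sub>R \<alpha> + 1 *\<^sub>R \<beta>] = 0"
    using assms by (intro bivector_diag cotangent_space_lincomb)
  moreover have "P [1 *\<^sub>R \<alpha> + 1 *\<^sub>R \<beta>, 1 *\<^sub>R \<alpha> + 1 *\<^sub>R \<beta>] =
      1 * P [1 *\<^sub>R \<alpha> + 1 *\<^sub>R \<beta>, \<alpha>] + 1 * P [1 *\<^sub>R \<alpha> + 1 *\<^sub>R \<beta>, \<beta>]"
    using assms by (intro bivector_linear_right cotangent_space_lincomb)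
  ultimately show ?thesis
    using bivector_linear_left[OF assms(1,2,2,3), of 1 1] bivector_linear_left[OF assms(1,3,2,3), of 1 1]
      bivector_diag[OF assms(1,2)] bivector_diag[OF assms(1,3)] by simp
qed

lemma bivector_sum_right:
  assumes "P \<in> multivectors A 2 x" "\<alpha> \<in> cotangent_space A x"
    "\<And>k. k \<in> I \<Longrightarrow> \<theta> k \<in> cotangent_space A x"
  shows "P [\<alpha>, \<Sum>k\<in>I. r k *\<^sub>R \<theta> k] = (\<Sum>k\<in>I. r k * P [\<alpha>, \<theta> k])"
proof -
  have 0: "P [\<alpha>, 0] = 0"
    using bivector_linear_right[OF assms(1,2) cotangent_space_zero cotangent_space_zero, of 0 0] by simp
  show ?thesis
    using assms(3)
  proof (induction I rule: infinite_finite_induct)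
    case (insert k I)
    then have "P [\<alpha>, r k *\<^sub>R \<theta> k + 1 *\<^sub>R (\<Sum>k\<in>I. r k *\<^sub>R \<theta> k)] =
        r k * P [\<alpha>, \<theta> k] + 1 * P [\<alpha>, \<Sum>k\<in>I. r k *\<^sub>R \<theta> k]"
      using assms(1,2) by (intro bivector_linear_right cotangent_space_sum) auto
    then show ?case
      unfolding sum.insert[OF insert.hyps(1,2)] scaleR_one mult_1
      using insert.IH insert.prems by (simp only: insertI2)
  qed (simp_all add: 0)
qed

text \<open>Linearity in the second slot reduces that slot to the generators; antisymmetry then
  moves the first slot into second position, where the same reduction applies.\<close>

lemma bivector_eqI:
  assumes P: "P \<in> multivectors A 2 x" and Q: "Q \<in> multivectors A 2 x"
    and \<theta>: "\<And>k. k \<in> I \<Longrightarrow> \<theta> k \<in> cotangent_space A x"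
    and gen: "\<And>\<alpha>. \<alpha> \<in> cotangent_space A x \<Longrightarrow> \<exists>r. \<alpha> = (\<Sum>k\<in>I. r k *\<^sub>R \<theta> k)"
    and eq: "\<And>k l. k \<in> I \<Longrightarrow> l \<in> I \<Longrightarrow> P [\<theta> k, \<theta> l] = Q [\<theta> k, \<theta> l]"
  shows "P = Q"
proof
  fix \<alpha>s
  show "P \<alpha>s = Q \<alpha>s"
  proof (cases "length \<alpha>s = 2 \<and> set \<alpha>s \<subseteq> cotangent_space A x")
    case True
    then obtain \<alpha> \<beta> where \<alpha>s: "\<alpha>s = [\<alpha>, \<beta>]"
      by (auto simp: numeral_2_eq_2 length_Suc_conv)
    have 1: "P [\<theta> k, \<gamma>] = Q [\<theta> k, \<gamma>]" if "k \<in> I" "\<gamma> \<in> cotangent_space A x" for k \<gamma>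
    proof -
      obtain r where r: "\<gamma> = (\<Sum>k\<in>I. r k *\<^sub>R \<theta> k)"
        using gen[OF \<open>\<gamma> \<in> cotangent_space A x\<close>] by blast
      show ?thesis
        using bivector_sum_right[OF P \<theta>[OF that(1)], of I \<theta> r]
          bivector_sum_right[OF Q \<theta>[OF that(1)], of I \<theta> r] \<theta> eq[OF that(1)]
        by (simp add: r)
    qed
    have ab: "\<alpha> \<in> cotangent_space A x" "\<beta> \<in> cotangent_space A x"
      using True \<alpha>s by auto
    obtain r where r: "\<alpha> = (\<Sum>k\<in>I. r k *\<^sub>R \<theta> k)"
      using gen[OF ab(1)] by blast
    have "P [\<beta>, \<alpha>] = Q [\<beta>, \<alpha>]"
    proof -
      have "P [\<beta>, \<theta> k] = Q [\<beta>, \<theta> k]" if "k \<in> I" for k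
        using 1[OF that ab(2)] bivector_antisym[OF P ab(2) \<theta>[OF that]]
          bivector_antisym[OF Q ab(2) \<theta>[OF that]] by simp
      then show ?thesis
        using bivector_sum_right[OF P ab(2), of I \<theta> r] bivector_sum_right[OF Q ab(2), of I \<theta> r] \<theta>
        by (simp add: r)
    qed
    then show ?thesis
      using bivector_antisym[OF P ab] bivector_antisym[OF Q ab] \<alpha>s by simp
  next
    case False
    then show ?thesis
      using multivector_outside[OF P] multivector_outside[OF Q] by simp
  qed
qed

text \<open>The coordinate covectors of a single chart already separate tangent vectors.\<close>

lemma tangent_eqI_cotangent:
  assumes "v \<in> tangent_space A x" "w \<in> tangent_space A x" "x \<in> topspace M"
    "\<And>\<beta>. \<beta> \<in> cotangent_space A x \<Longrightarrow> \<beta> v = \<beta> w"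
  shows "v = w"
proof -
  obtain c where c: "c \<in> A" "x \<in> fst c"
    using assms ex_chart by blast
  have "covector c x (\<lambda>u. u $ k) \<in> cotangent_space A x" for k
    by (intro covector_in_cotangent_space bounded_linear.linear[OF bounded_linear_vec_nth])
  then have "v c = w c"
    using assms(1,2) assms(4)[of "covector c x (\<lambda>u. u $ _)"] by (simp add: covector_def vec_eq_iff)
  then show ?thesis
    using tangent_eqI[OF assms(1,2) c] by blast
qed

lemma sharp_eqI:
  assumes "x \<in> topspace M" "v \<in> tangent_space A x"
    "\<And>\<beta>. \<beta> \<in> cotangent_space A x \<Longrightarrow> \<beta> v = P x [\<alpha>, \<beta>]"
  shows "sharp A P x \<alpha> = v"
  unfolding sharp_def
proof (rule the_equality)
  show "w = v" if "w \<in> tangent_space A x \<and> (\<forall>\<beta>\<in>cotangent_space A x. \<beta> w = P x [\<alpha>, \<beta>])" for w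
    using that assms by (intro tangent_eqI_cotangent) auto
qed (use assms in auto)

text \<open>\<open>sharp\<close> describes a vector by its pairings with all covectors. That such a
  vector exists is the reflexivity of the tangent space, shown here in coordinates.\<close>

lemma sharp_works:
  assumes x: "x \<in> topspace M" and P: "P x \<in> multivectors A 2 x"
    and \<alpha>: "\<alpha> \<in> cotangent_space A x" and \<beta>: "\<beta> \<in> cotangent_space A x"
  shows "\<beta> (sharp A P x \<alpha>) = P x [\<alpha>, \<beta>]"
proof -
  obtain c where c: "c \<in> A" "x \<in> fst c"
    using x ex_chart by blast
  define e where "e k = covector c x (\<lambda>u. u $ k)" for k
  have e: "e k \<in> cotangent_space A x" for k
    unfolding e_def by (intro covector_in_cotangent_space bounded_linear.linear[OF bounded_linear_vec_nth])
  \<comment> \<open>Component \<open>k\<close> has to be the value of the coordinate covector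
    \<open>e k\<close> on the vector sought.\<close>
  define v where "v = lift c x (\<chi> k. P x [\<alpha>, e k])"
  have v: "v \<in> tangent_space A x"
    unfolding v_def by (rule lift_in_tangent_space[OF c])
  have main: "\<beta> v = P x [\<alpha>, \<beta>]" if \<beta>: "\<beta> \<in> cotangent_space A x" for \<beta>
  proof -
    have lin: "\<beta> (lift c x w) = (\<Sum>k\<in>UNIV. w $ k * \<beta> (lift c x (axis k 1)))" for w
      using linear_eq_sum_axis[OF linear_cotangent_lift[OF \<beta> c], of w] by simp
    have "\<beta> u = (\<Sum>k\<in>UNIV. \<beta> (lift c x (axis k 1)) *\<^sub>R e k) u" for u
    proof (cases "u \<in> tangent_space A x")
      case True
      then show ?thesis
        using lin[of "u c"] lift_tangent[OF True c]
        by (simp add: sum_fun_eval scaleR_fun_eval e_def covector_def mult.commute)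
    next
      case False
      then show ?thesis
        using \<beta> by (simp add: sum_fun_eval scaleR_fun_eval e_def covector_def cotangent_space_def)
    qed
    then have "\<beta> = (\<Sum>k\<in>UNIV. \<beta> (lift c x (axis k 1)) *\<^sub>R e k)"
      by (rule ext)
    then have "P x [\<alpha>, \<beta>] = P x [\<alpha>, \<Sum>k\<in>UNIV. \<beta> (lift c x (axis k 1)) *\<^sub>R e k]"
      by (rule arg_cong[where f = "\<lambda>\<gamma>. P x [\<alpha>, \<gamma>]"])
    also have "\<dots> = (\<Sum>k\<in>UNIV. \<beta> (lift c x (axis k 1)) * P x [\<alpha>, e k])"
      by (rule bivector_sum_right[OF P \<alpha> e, of "\<lambda>k. \<beta> (lift c x (axis k 1))"])
    also have "\<dots> = \<beta> v"
      using lin[of "\<chi> k. P x [\<alpha>, e k]"] by (simp add: v_def mult.commute)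
    finally show ?thesis by simp
  qed
  then show ?thesis
    using sharp_eqI[where P = P, OF x v main] \<beta> by simp
qed

section \<open>The bracket of bivector fields\<close>

abbreviation swap01 :: "nat \<Rightarrow> nat" where
  "swap01 \<equiv> Transposition.transpose 0 1"

abbreviation swap12 :: "nat \<Rightarrow> nat" where
  "swap12 \<equiv> Transposition.transpose 1 2"

lemma swap_values [simp]:
  "swap12 0 = 0" "swap12 1 = 2" "swap12 (Suc 0) = 2" "swap12 2 = 1" "n \<ge> 3 \<Longrightarrow> swap12 n = n"
  "swap01 0 = 1" "swap01 1 = 0" "swap01 (Suc 0) = 0" "swap01 2 = 2" "n \<ge> 3 \<Longrightarrow> swap01 n = n"
  by (simp_all add: Transposition.transpose_def)

text \<open>The first two values are in increasing order, so an unshuffle is determined by its value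
  at 2; monotonicity on a single point is no condition. The composition
  \<open>swap01 \<circ> swap12\<close> is the cycle sending 0 to 1, 1 to 2 and 2 to 0.\<close>

lemma unshuffles_2_3: "unshuffles 2 3 = {id, swap12, swap01 \<circ> swap12}"
proof
  show "unshuffles 2 3 \<subseteq> {id, swap12, swap01 \<circ> swap12}"
  proof
    fix \<sigma> assume "\<sigma> \<in> unshuffles 2 3"
    then have p: "\<sigma> permutes {0..<3}" and "strict_mono_on {0..<2} \<sigma>"
      by (auto simp: unshuffles_def)
    then have lt: "\<sigma> 0 < \<sigma> 1"
      by (simp add: strict_mono_on_def)
    have r: "\<sigma> 0 < 3" "\<sigma> 1 < 3" "\<sigma> 2 < 3"
      using permutes_in_image[OF p] by auto
    have ne: "\<sigma> 0 \<noteq> \<sigma> 2" "\<sigma> 1 \<noteq> \<sigma> 2"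
      using injD[OF permutes_inj[OF p]] by fastforce+
    have eqI: "\<sigma> = \<tau>"
      if "\<sigma> 0 = \<tau> 0" "\<sigma> 1 = \<tau> 1" "\<sigma> 2 = \<tau> 2" "\<And>n. n \<ge> 3 \<Longrightarrow> \<tau> n = n" for \<tau>
    proof
      fix n :: nat
      consider "n = 0" | "n = 1" | "n = 2" | "n \<ge> 3" by linarith
      moreover have "\<sigma> n = n" if "n \<ge> 3" for n
        using p that by (simp add: permutes_def)
      ultimately show "\<sigma> n = \<tau> n" using that by cases simp_all
    qed
    have "(\<sigma> 0 = 0 \<and> \<sigma> 1 = 1 \<and> \<sigma> 2 = 2) \<or> (\<sigma> 0 = 0 \<and> \<sigma> 1 = 2 \<and> \<sigma> 2 = 1) \<or>
        (\<sigma> 0 = 1 \<and> \<sigma> 1 = 2 \<and> \<sigma> 2 = 0)"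
      using lt r ne by linarith
    then show "\<sigma> \<in> {id, swap12, swap01 \<circ> swap12}"
      using eqI[of id] eqI[of swap12] eqI[of "swap01 \<circ> swap12"] by force
  qed
  have p: "swap12 permutes {0..<3}" "swap01 permutes {0..<3}"
    by (simp_all add: permutes_swap_id)
  have "strict_mono_on {0..<2} \<sigma>" "strict_mono_on {2..<3} \<sigma>" if "\<sigma> 0 < \<sigma> 1" for \<sigma> :: "nat \<Rightarrow> nat"
    using that by (auto simp: strict_mono_on_def less_2_cases_iff)
  then show "{id, swap12, swap01 \<circ> swap12} \<subseteq> unshuffles 2 3"
    using p permutes_compose[OF p] by (simp add: unshuffles_def permutes_id)
qed

text \<open>The identity and the 3-cycle are even and the transposition is odd, whence the signs.
  For \<open>P = Q\<close> this is the Jacobiator of the function bracket of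
  \<open>P\<close>.\<close>

lemma insertion_bivectors:
  "insertion A 2 P 2 Q [f, g, h] x =
     P x [differential A (\<lambda>y. Q y [differential A f y, differential A g y]) x, differential A h x]
   - P x [differential A (\<lambda>y. Q y [differential A f y, differential A h y]) x, differential A g x]
   + P x [differential A (\<lambda>y. Q y [differential A g y, differential A h y]) x, differential A f x]"
proof -
  \<comment> \<open>The sum over the three-element set splits only after the permutations are known
    to be distinct.\<close>
  have "id 1 \<noteq> swap12 1" "id 0 \<noteq> (swap01 \<circ> swap12) 0" "swap12 0 \<noteq> (swap01 \<circ> swap12) 0"
    by simp_all
  then have ne: "id \<noteq> swap12" "id \<noteq> swap01 \<circ> swap12" "swap12 \<noteq> swap01 \<circ> swap12"
    by metis+
  have s: "sign swap12 = -1" "sign (swap01 \<circ> swap12) = 1"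
    by (simp_all add: sign_swap_id sign_compose permutation_swap_id)
  have l: "[0..<2] = [0, 1::nat]" "[2..<3] = [2::nat]"
    by (simp_all add: upt_rec)
  have "insertion A 2 P 2 Q [f, g, h] x = (\<Sum>\<sigma>\<in>unshuffles 2 3. of_int (sign \<sigma>) *
           P x (differential A
                  (\<lambda>y. Q y (map (\<lambda>i. differential A ([f, g, h] ! \<sigma> i) y) [0..<2])) x
                # map (\<lambda>i. differential A ([f, g, h] ! \<sigma> i) x) [2..<3]))"
    by (simp add: insertion_def)
  then show ?thesis
    unfolding unshuffles_2_3 using ne s by (simp add: l sign_id)
qed

text \<open>Two facts determine the description in \<open>schouten\<close>: all admissible lists
  give 0, and an admissible list exists. Without the second, every real number would satisfy
  it.\<close>

lemma schouten_eq_0I: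
  assumes "W \<subseteq> topspace M"
    and "\<And>x fs. x \<in> W \<Longrightarrow> length fs = p + q - 1 \<Longrightarrow>
      (\<And>f. f \<in> set fs \<Longrightarrow> \<exists>V. openin M V \<and> x \<in> V \<and> smooth_map_on A V f) \<Longrightarrow>
      schouten_on_functions A p P q Q fs x = 0"
  shows "schouten M A W p P q Q = 0"
proof (intro ext)
  fix x \<alpha>s
  let ?adm = "\<lambda>fs. (\<forall>f\<in>set fs. \<exists>V. openin M V \<and> x \<in> V \<and> smooth_map_on A V f) \<and>
      map (\<lambda>f. differential A f x) fs = \<alpha>s"
  show "schouten M A W p P q Q x \<alpha>s = 0 x \<alpha>s"
  proof (cases "x \<in> W \<and> length \<alpha>s = p + q - 1 \<and> set \<alpha>s \<subseteq> cotangent_space A x")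
    case True
    have zero: "schouten_on_functions A p P q Q fs x = 0" if "?adm fs" for fs
      using assms(2)[of x fs] that True by (metis length_map)
    have "\<forall>\<alpha>\<in>set \<alpha>s. \<exists>f V. openin M V \<and> x \<in> V \<and> smooth_map_on A V f \<and> differential A f x = \<alpha>"
      using ex_function_with_differential True assms(1) by blast
    then obtain F where F: "\<And>\<alpha>. \<alpha> \<in> set \<alpha>s \<Longrightarrow>
        (\<exists>V. openin M V \<and> x \<in> V \<and> smooth_map_on A V (F \<alpha>)) \<and> differential A (F \<alpha>) x = \<alpha>"
      by metis
    have adm: "?adm (map F \<alpha>s)"
      using F by (auto simp: map_idI)
    have "(THE r. \<forall>fs. ?adm fs \<longrightarrow> r = schouten_on_functions A p P q Q fs x) = 0"
    proof (rule the_equality)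
      show "r = 0" if "\<forall>fs. ?adm fs \<longrightarrow> r = schouten_on_functions A p P q Q fs x" for r
        using mp[OF spec[OF that] adm] zero[OF adm] by (rule trans)
    qed (simp add: zero)
    then show ?thesis
      using True by (simp add: schouten_def)
  qed (auto simp: schouten_def)
qed

end

section \<open>Coordinate systems from first integrals\<close>

text \<open>The rows other than \<open>k0\<close> are one fewer than the dimension, so they do not
  span and some unit vector lies outside their span; adding it keeps the rows independent. A unit
  vector is wanted because it is the differential of a chart coordinate.\<close>

lemma ex_axis_completing_rows:
  fixes R :: "'n::finite \<Rightarrow> real^'n"
  assumes indep: "\<And>r k. (\<Sum>k\<in>-{k0}. r k *\<^sub>R R k) = 0 \<Longrightarrow> k \<noteq> k0 \<Longrightarrow> r k = 0"
  shows "\<exists>l. det (\<chi> a. if a = k0 then axis l 1 else R a) \<noteq> 0"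
proof -
  have "\<exists>l. axis l (1::real) \<notin> span (R ` (-{k0}))"
  proof (rule ccontr)
    assume "\<not> ?thesis"
    then have ax: "axis l (1::real) \<in> span (R ` (-{k0}))" for l by blast
    have "w \<in> span (R ` (-{k0}))" for w
    proof -
      have "(\<Sum>j\<in>UNIV. w $ j *\<^sub>R axis j (1::real)) \<in> span (R ` (-{k0}))"
        by (intro span_sum span_scale ax)
      then show ?thesis
        using linear_eq_sum_axis[OF linear_id, of w] by simp
    qed
    then have "dim (UNIV :: (real^'n) set) \<le> card (R ` (-{k0}))"
      by (intro dim_le_card) auto
    also have "\<dots> \<le> card (-{k0})"
      by (rule card_image_le) simp
    also have "\<dots> < CARD('n)"
      by (rule psubset_card_mono) auto
    finally show False by simp
  qed
  then obtain l where l: "axis l (1::real) \<notin> span (R ` (-{k0}))" by blast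
  let ?J = "(\<chi> a. if a = k0 then axis l 1 else R a) :: real^'n^'n"
  have "r i = 0" if r: "(\<Sum>i\<in>UNIV. r i *s row i ?J) = 0" for r i
  proof -
    have row: "row i ?J = (if i = k0 then axis l 1 else R i)" for i
      by (simp add: row_def)
    have "(\<Sum>i\<in>UNIV. r i *s row i ?J) = r k0 *\<^sub>R axis l 1 + (\<Sum>i\<in>-{k0}. r i *s row i ?J)"
      by (simp add: sum.remove[of UNIV k0] row Compl_eq_Diff_UNIV scalar_mult_eq_scaleR)
    also have "(\<Sum>i\<in>-{k0}. r i *s row i ?J) = (\<Sum>k\<in>-{k0}. r k *\<^sub>R R k)"
      by (rule sum.cong) (simp_all add: row scalar_mult_eq_scaleR)
    finally have eq: "r k0 *\<^sub>R axis l 1 + (\<Sum>k\<in>-{k0}. r k *\<^sub>R R k) = 0"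
      using r by simp
    have "r k0 = 0"
    proof (rule ccontr)
      assume nz: "r k0 \<noteq> 0"
      have "(\<Sum>k\<in>-{k0}. r k *\<^sub>R R k) \<in> span (R ` (-{k0}))"
        by (intro span_sum span_scale span_base) auto
      then have "(- inverse (r k0)) *\<^sub>R (\<Sum>k\<in>-{k0}. r k *\<^sub>R R k) \<in> span (R ` (-{k0}))"
        by (rule span_scale)
      moreover have "(\<Sum>k\<in>-{k0}. r k *\<^sub>R R k) = - (r k0 *\<^sub>R axis l 1)"
        using eq by (simp add: eq_neg_iff_add_eq_0 add.commute)
      ultimately show False
        using l nz by simp
    qed
    then show ?thesis
      using indep[of r i] eq by (cases "i = k0") simp_all
  qed
  then have "invertible ?J"
    unfolding invertible_right_inverse matrix_right_invertible_independent_rows by blast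
  then show ?thesis
    by (auto simp: invertible_det_nz)
qed

text \<open>The bijection \<open>b\<close> turns the coordinate indices other than \<open>k0\<close> into those of the first
  integrals, so that coordinate systems can consist of the \<open>h i\<close> and one more function.\<close>

locale first_integrals = manifold M A
  for M :: "'a topology" and A :: "('a, 'n::finite) chart set" +
  fixes m :: nat and X :: "'a \<Rightarrow> ('a, 'n) tangent" and h :: "nat \<Rightarrow> 'a \<Rightarrow> real" and U :: "'a set"
    and b :: "'n \<Rightarrow> nat" and k0 :: 'n
  assumes vector_field: "vector_field A (topspace M) X"
    and first_integral: "\<And>i. i \<in> {1..m - 1} \<Longrightarrow> first_integral A (topspace M) X (h i)"
    and openin_U: "openin M U"
    and independent: "independent_functions_on A U {1..m - 1} h"
    and bij_b: "bij_betw b (- {k0}) {1..m - 1}"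
begin

lemma U_subset: "U \<subseteq> topspace M"
  using openin_subset[OF openin_U] .

lemma b_in: "k \<noteq> k0 \<Longrightarrow> b k \<in> {1..m - 1}"
  using bij_betwE[OF bij_b] by simp

lemma ex_index:
  assumes "i \<in> {1..m - 1}"
  obtains k where "k \<noteq> k0" "i = b k"
proof -
  have "i \<in> b ` (- {k0})"
    unfolding bij_betw_imp_surj_on[OF bij_b] by (rule assms)
  then show thesis
    using that by blast
qed

lemma smooth_h: "i \<in> {1..m - 1} \<Longrightarrow> smooth_map_on A (topspace M) (h i)"
  using first_integral by (simp add: first_integral_def)

lemma differential_h_X: "i \<in> {1..m - 1} \<Longrightarrow> x \<in> topspace M \<Longrightarrow> differential A (h i) x (X x) = 0"
  using first_integral by (simp add: first_integral_def)

lemma X_tangent: "x \<in> topspace M \<Longrightarrow> X x \<in> tangent_space A x"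
  using vector_field by (simp add: vector_field_def)

lemma differential_h_cotangent:
  "i \<in> {1..m - 1} \<Longrightarrow> x \<in> topspace M \<Longrightarrow> differential A (h i) x \<in> cotangent_space A x"
  by (rule differential_in_cotangent_space[OF openin_topspace _ smooth_h])

text \<open>The completed family read in the chart \<open>c\<close>: slot \<open>k0\<close> holds a
  chart coordinate, the other slots hold the integrals. Which coordinate \<open>l\<close> works
  depends on the point, so it is a parameter.\<close>

definition coord :: "'n \<Rightarrow> ('a, 'n) chart \<Rightarrow> 'n \<Rightarrow> real^'n \<Rightarrow> real" where
  "coord l c k = (if k = k0 then (\<lambda>p. p $ l) else h (b k) \<circ> chart_inv c)"

lemma smooth_coord: "c \<in> A \<Longrightarrow> Cinf_on (snd c ` (fst c \<inter> topspace M)) (coord l c k)"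
  using smooth_map_onD[OF smooth_h[OF b_in]] Cinf_on_component[OF open_image_chart Cinf_on_ident]
  by (simp add: coord_def)

lemma ex_coordinate_functions:
  assumes "openin M V" "x \<in> V" "V \<subseteq> U" "c \<in> A" "x \<in> fst c"
  shows "\<exists>l S. snd c x \<in> S \<and> S \<subseteq> snd c ` (fst c \<inter> V) \<and> coordinate_functions S (coord l c)"
proof -
  let ?p = "snd c x"
  let ?S0 = "snd c ` (fst c \<inter> V)"
  have S0: "open ?S0"
    by (rule open_image_chart[OF assms(4,1)])
  have p: "?p \<in> ?S0"
    using assms by blast
  have sub: "?S0 \<subseteq> snd c ` (fst c \<inter> topspace M)"
    using assms(1) openin_subset by blast
  have x: "x \<in> topspace M" "x \<in> U"
    using assms(1,2,3) openin_subset by blast+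
  have smooth: "Cinf_on ?S0 (coord l c k)" for l k
    using Cinf_on_subset[OF smooth_coord[OF assms(4)] sub] .
  define D where "D k = frechet_derivative (h (b k) \<circ> chart_inv c) (at ?p)" for k
  define R where "R k = (\<chi> a. D k (axis a 1))" for k
  have D: "D k w = R k \<bullet> w" if "k \<noteq> k0" for k w
  proof -
    \<comment> \<open>The index \<open>l\<close> enters \<open>coord\<close> only in slot
      \<open>k0\<close>, so any value, here \<open>undefined\<close>, serves for the other
      slots.\<close>
    have "linear (D k)"
      using has_derivative_linear[OF Cinf_on_imp_has_derivative[OF smooth[of undefined k] S0 p]] that
      by (simp add: D_def coord_def)
    from linear_eq_sum_axis[OF this, of w] show ?thesis
      by (simp add: R_def inner_vec_def mult.commute)
  qed
  have dh: "differential A (h (b k)) x v = (if v \<in> tangent_space A x then R k \<bullet> v c else 0)"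
    if "k \<noteq> k0" for k v
    using differential_eq_covector[OF openin_topspace x(1) smooth_h[OF b_in[OF that]] assms(4,5)]
      D[OF that] by (simp add: covector_def D_def)
  have "\<exists>l. det (\<chi> a. if a = k0 then axis l 1 else R a) \<noteq> 0"
  proof (rule ex_axis_completing_rows)
    fix r k assume r: "(\<Sum>k\<in>-{k0}. r k *\<^sub>R R k) = 0" and k: "k \<noteq> k0"
    \<comment> \<open>This inverse carries a linear relation between the rows \<open>R k\<close>
      over to one between the differentials of the \<open>h i\<close>, to which independence
      applies.\<close>
    define inv_b where "inv_b = inv_into (-{k0}) b"
    have inv_b: "inv_b (b k) = k" if "k \<noteq> k0" for k
      using bij_b that by (simp add: inv_b_def bij_betw_def)
    have "(\<Sum>i\<in>{1..m - 1}. r (inv_b i) *\<^sub>R differential A (h i) x) v = 0" for v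
    proof -
      have "(\<Sum>i\<in>{1..m - 1}. r (inv_b i) *\<^sub>R differential A (h i) x) v =
          (\<Sum>i\<in>{1..m - 1}. r (inv_b i) * differential A (h i) x v)"
        by (simp add: sum_fun_eval scaleR_fun_eval)
      also have "\<dots> = (\<Sum>k\<in>-{k0}. r (inv_b (b k)) * differential A (h (b k)) x v)"
        by (rule sum.reindex_bij_betw[OF bij_b, symmetric])
      also have "\<dots> = (\<Sum>k\<in>-{k0}. if v \<in> tangent_space A x then r k * (R k \<bullet> v c) else 0)"
        by (rule sum.cong) (simp_all add: inv_b dh)
      also have "\<dots> = (if v \<in> tangent_space A x then (\<Sum>k\<in>-{k0}. r k *\<^sub>R R k) \<bullet> v c else 0)"
        by (simp add: inner_sum_left)
      finally show ?thesis
        using r by simp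
    qed
    then have "(\<Sum>i\<in>{1..m - 1}. r (inv_b i) *\<^sub>R differential A (h i) x) = 0"
      by (intro ext) simp
    then have "\<forall>i\<in>{1..m - 1}. r (inv_b i) = 0"
      by (rule mp[OF spec[OF bspec[OF independent[unfolded independent_functions_on_def] x(2)],
              of "\<lambda>i. r (inv_b i)"]])
    then show "r k = 0"
      using b_in[OF k] inv_b[OF k] by metis
  qed
  then obtain l where l: "det (\<chi> a. if a = k0 then axis l 1 else R a) \<noteq> 0"
    by blast
  define dJ where
    "dJ q = det (\<chi> a d. frechet_derivative (coord l c a) (at q) (axis d 1))" for q
  have "frechet_derivative (coord l c k0) (at ?p) = (\<lambda>w. w $ l)"
    by (simp add: coord_def flip: frechet_derivative_at[OF
          bounded_linear_imp_has_derivative[OF bounded_linear_vec_nth]])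
  then have "(\<chi> a d. frechet_derivative (coord l c a) (at ?p) (axis d 1)) =
      (\<chi> a. if a = k0 then axis l 1 else R a)"
    by (auto simp: vec_eq_iff R_def D_def coord_def axis_def)
  then have "dJ ?p \<noteq> 0"
    using l by (simp add: dJ_def)
  \<comment> \<open>So far the determinant is known to be nonzero only at the given point; by
    continuity it stays so on an open set, which becomes \<open>S\<close>.\<close>
  moreover have "continuous_on ?S0 dJ"
    unfolding dJ_def[abs_def]
    by (intro Cinf_on_imp_continuous_on Cinf_on_det[OF S0] Cinf_on_derivative smooth)
  then have "open (?S0 \<inter> dJ -` (- {0}))"
    by (rule continuous_open_preimage[OF _ S0]) auto
  moreover have "Cinf_on (?S0 \<inter> dJ -` (- {0})) (coord l c k)" for k
    using Cinf_on_subset[OF smooth] by blast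
  ultimately show ?thesis
    using p by (intro exI[of _ l] exI[of _ "?S0 \<inter> dJ -` (- {0})"] conjI coordinate_functions.intro)
      (auto simp: dJ_def)
qed

section \<open>Dual vectors and the candidate bivector fields\<close>

definition dual :: "nat \<Rightarrow> 'a \<Rightarrow> ('a, 'n) tangent \<Rightarrow> bool" where
  "dual i x Y \<longleftrightarrow> Y \<in> tangent_space A x \<and>
     (\<forall>j\<in>{1..m - 1}. differential A (h j) x Y = (if i = j then 1 else 0))"

text \<open>An arbitrary choice at every point, so no regularity in \<open>x\<close> can be expected
  from it.\<close>

definition dual_vector :: "nat \<Rightarrow> 'a \<Rightarrow> ('a, 'n) tangent" where
  "dual_vector i x = (SOME Y. dual i x Y)"

text \<open>\<open>Y \<and> X\<close> does not depend on the choice of \<open>Y\<close>: two choices differ by a vector in the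
  common kernel of the \<open>d h j\<close>, which is a line that contains \<open>X\<close>.\<close>

definition poisson :: "nat \<Rightarrow> 'a \<Rightarrow> ('a, 'n) multivector" where
  "poisson i x \<alpha>s = (if x \<in> U \<and> length \<alpha>s = 2 \<and> set \<alpha>s \<subseteq> cotangent_space A x
     then (\<alpha>s ! 0) (dual_vector i x) * (\<alpha>s ! 1) (X x) - (\<alpha>s ! 0) (X x) * (\<alpha>s ! 1) (dual_vector i x)
     else 0)"

lemma poisson_multivector:
  "poisson i x \<in> multivectors A 2 x"
proof -
  have lin: "poisson i x (\<alpha>s[k := r *\<^sub>R \<beta> + s *\<^sub>R \<gamma>]) = r * poisson i x (\<alpha>s[k := \<beta>]) + s * poisson i x (\<alpha>s[k := \<gamma>])"
    if "\<beta> \<in> cotangent_space A x" "\<gamma> \<in> cotangent_space A x"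
      "length \<alpha>s = 2" "set \<alpha>s \<subseteq> cotangent_space A x" "k < 2" for \<alpha>s k r s \<beta> \<gamma>
  proof -
    obtain \<alpha> \<alpha>' where \<alpha>s: "\<alpha>s = [\<alpha>, \<alpha>']"
      using \<open>length \<alpha>s = 2\<close> by (auto simp: numeral_2_eq_2 length_Suc_conv)
    have lc: "r *\<^sub>R \<beta> + s *\<^sub>R \<gamma> \<in> cotangent_space A x"
      using that by (intro cotangent_space_lincomb)
    have ev: "(r *\<^sub>R \<beta> + s *\<^sub>R \<gamma>) v = r * \<beta> v + s * \<gamma> v" for v
      by (simp add: scaleR_fun_eval)
    consider "k = 0" | "k = 1" using \<open>k < 2\<close> by linarith
    then show ?thesis
    proof cases
      case 1
      show ?thesis
        using that lc unfolding \<alpha>s 1 poisson_def list_update.simps nat.case nth_Cons_0 One_nat_def nth_Cons_Suc ev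
        by (simp add: algebra_simps)
    next
      case 2
      show ?thesis
        using that lc unfolding \<alpha>s 2 poisson_def list_update.simps nat.case nth_Cons_0 One_nat_def nth_Cons_Suc ev
        by (simp add: algebra_simps)
    qed
  qed
  have diag: "poisson i x \<alpha>s = 0"
    if "length \<alpha>s = 2" "k < l" "l < 2" "\<alpha>s ! k = \<alpha>s ! l" for \<alpha>s k l
  proof -
    have "k = 0" "l = 1" using that by linarith+
    then show ?thesis using that(4) by (simp add: poisson_def mult.commute)
  qed
  show ?thesis
    unfolding multivectors_def mem_Collect_eq
  proof (intro conjI allI ballI impI; (elim conjE)?)
    show "poisson i x \<alpha>s = 0" if "\<not> (length \<alpha>s = 2 \<and> set \<alpha>s \<subseteq> cotangent_space A x)" for \<alpha>s
      using that by (auto simp: poisson_def)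
    show "poisson i x (\<alpha>s[k := r *\<^sub>R \<beta> + s *\<^sub>R \<gamma>]) = r * poisson i x (\<alpha>s[k := \<beta>]) + s * poisson i x (\<alpha>s[k := \<gamma>])"
      if "\<beta> \<in> cotangent_space A x" "\<gamma> \<in> cotangent_space A x"
        "length \<alpha>s = 2" "set \<alpha>s \<subseteq> cotangent_space A x" "k < 2" for \<alpha>s k r s \<beta> \<gamma>
      using that by (rule lin)
    show "poisson i x \<alpha>s = 0"
      if "length \<alpha>s = 2" "k < l" "l < 2" "\<alpha>s ! k = \<alpha>s ! l" for \<alpha>s k l
      using that by (rule diag)
  qed
qed

lemma poisson_outside: "x \<notin> U \<Longrightarrow> poisson i x = 0"
  by (intro ext) (simp add: poisson_def)

lemma poisson_apply:
  "x \<in> U \<Longrightarrow> \<alpha> \<in> cotangent_space A x \<Longrightarrow> \<beta> \<in> cotangent_space A x \<Longrightarrow>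
    poisson i x [\<alpha>, \<beta>] = \<alpha> (dual_vector i x) * \<beta> (X x) - \<alpha> (X x) * \<beta> (dual_vector i x)"
  by (simp add: poisson_def)

end

section \<open>The vector field and the bivector fields in a local dual frame\<close>

locale integral_frame = first_integrals M A m X h U b k0
  for M :: "'a topology" and A :: "('a, 'n::finite) chart set" and m X h U b k0 +
  fixes c :: "('a, 'n) chart" and l :: 'n and S :: "(real^'n) set"
  assumes c_in: "c \<in> A" and S_sub: "S \<subseteq> snd c ` (fst c \<inter> U)"
    and coordinate_functions: "coordinate_functions S (coord l c)"
begin

sublocale coordinate_functions S "coord l c"
  by (rule coordinate_functions)

text \<open>The coefficient of \<open>X\<close> along \<open>E k0\<close>, obtained as the
  derivative of the \<open>l\<close>-th chart coordinate along \<open>X\<close>. On \<open>S\<close>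
  it vanishes exactly at the zeros of \<open>X\<close>.\<close>

definition u :: "real^'n \<Rightarrow> real" where
  "u p = X (chart_inv c p) c $ l"

lemma smooth_u: "Cinf_on S u"
proof -
  have "smooth_map_on A (fst c \<inter> topspace M) (\<lambda>x. X x c)"
    using vector_field c_in by (simp add: vector_field_def)
  from smooth_map_onD[OF this c_in]
  have "Cinf_on S ((\<lambda>x. X x c) \<circ> chart_inv c)"
    by (rule Cinf_on_subset) (use S_sub U_subset in blast)
  from Cinf_on_component[OF open_S this, of l] show ?thesis
    by (simp add: u_def[abs_def])
qed

lemma in_U:
  assumes "y \<in> fst c" "snd c y \<in> S"
  shows "y \<in> U"
proof -
  obtain z where "z \<in> fst c" "z \<in> U" "snd c y = snd c z"
    using assms S_sub by blast
  then show ?thesis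
    using inj_onD[OF inj_on_chart[OF c_in] _ assms(1)] by metis
qed

lemma derivative_coord_k0:
  "frechet_derivative (coord l c k0) (at p) w = w $ l"
  by (simp add: coord_def flip: frechet_derivative_at[OF
        bounded_linear_imp_has_derivative[OF bounded_linear_vec_nth]])

lemma differential_h_coord:
  assumes "y \<in> fst c" "snd c y \<in> S" "k \<noteq> k0"
  shows "differential A (h (b k)) y = covector c y (frechet_derivative (coord l c k) (at (snd c y)))"
  using differential_eq_covector[OF openin_topspace _ smooth_h[OF b_in[OF assms(3)]] c_in assms(1)]
    in_U[OF assms(1,2)] U_subset assms(3) by (auto simp: coord_def)

lemma linear_derivative_coord:
  "p \<in> S \<Longrightarrow> linear (frechet_derivative (coord l c k) (at p))"
  by (rule has_derivative_linear[OF Cinf_on_imp_has_derivative[OF smooth_G open_S]])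

lemma derivatives_eqI:
  assumes "p \<in> S" "\<And>k. frechet_derivative (coord l c k) (at p) v = frechet_derivative (coord l c k) (at p) w"
  shows "v = w"
  using eq_zero_if_derivatives_zero[OF assms(1), of "v - w"] assms
  by (simp add: linear_diff[OF linear_derivative_coord])

text \<open>Both sides are killed by the differentials of the integrals and have the same
  \<open>l\<close>-th component; the differentials of the completed family determine the
  vector.\<close>

lemma X_eq_E:
  assumes "y \<in> fst c" "snd c y \<in> S"
  shows "X y c = u (snd c y) *\<^sub>R E k0 (snd c y)"
proof (rule derivatives_eqI[OF assms(2)])
  have y: "y \<in> topspace M"
    using in_U[OF assms] U_subset by blast
  have "frechet_derivative (coord l c k) (at (snd c y)) (X y c) = 0" if "k \<noteq> k0" for k
    using differential_h_X[OF b_in[OF that] y] differential_h_coord[OF assms that] X_tangent[OF y]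
    by (simp add: covector_def)
  then show "frechet_derivative (coord l c k) (at (snd c y)) (X y c) =
      frechet_derivative (coord l c k) (at (snd c y)) (u (snd c y) *\<^sub>R E k0 (snd c y))" for k
    using assms c_in derivative_coord_k0[of "snd c y" "X y c"]
    by (cases "k = k0")
      (simp_all add: linear_scale[OF linear_derivative_coord] derivative_G_E u_def)
qed

lemma b_eq_iff: "j \<noteq> k0 \<Longrightarrow> k \<noteq> k0 \<Longrightarrow> b j = b k \<longleftrightarrow> j = k"
  using bij_b by (auto simp: bij_betw_def inj_on_def)

text \<open>Duality prescribes all derivatives of the family along \<open>Y\<close> except that of
  slot \<open>k0\<close>. The \<open>l\<close>-th component is 0 for \<open>E k\<close> and 1 for
  \<open>E k0\<close>, so the missing multiple of \<open>E k0\<close> is the \<open>l\<close>-th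
  component of \<open>Y\<close>.\<close>

lemma dual_eq_E:
  assumes "y \<in> fst c" "snd c y \<in> S" "k \<noteq> k0" "dual (b k) y Y"
  shows "Y c = E k (snd c y) + (Y c $ l) *\<^sub>R E k0 (snd c y)"
proof (rule derivatives_eqI[OF assms(2)])
  fix j
  have "frechet_derivative (coord l c j) (at (snd c y)) (Y c) = (if j = k then 1 else 0)" if "j \<noteq> k0"
  proof -
    have "Y \<in> tangent_space A y" "differential A (h (b j)) y Y = (if b k = b j then 1 else 0)"
      using assms(4) b_in[OF that] unfolding dual_def by blast+
    then show ?thesis
      using b_eq_iff[OF assms(3) that]
      by (auto simp: differential_h_coord[OF assms(1,2) that] covector_def)
  qed
  then show "frechet_derivative (coord l c j) (at (snd c y)) (Y c) =
      frechet_derivative (coord l c j) (at (snd c y)) (E k (snd c y) + (Y c $ l) *\<^sub>R E k0 (snd c y))"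
    using assms(2,3) derivative_coord_k0[of "snd c y" "Y c"]
    by (cases "j = k0") (simp_all add: linear_add[OF linear_derivative_coord]
        linear_scale[OF linear_derivative_coord] derivative_G_E)
qed

lemma dual_lift_E:
  assumes "y \<in> fst c" "snd c y \<in> S" "k \<noteq> k0"
  shows "dual (b k) y (lift c y (E k (snd c y)))"
  unfolding dual_def
proof (intro conjI ballI)
  show t: "lift c y (E k (snd c y)) \<in> tangent_space A y"
    by (rule lift_in_tangent_space[OF c_in assms(1)])
  fix i assume "i \<in> {1..m - 1}"
  then obtain j where j: "j \<noteq> k0" "i = b j"
    by (rule ex_index)
  then show "differential A (h i) y (lift c y (E k (snd c y))) = (if b k = i then 1 else 0)"
    using differential_h_coord[OF assms(1,2) j(1)] t c_in assms b_eq_iff[OF assms(3) j(1)]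
    by (auto simp: covector_def derivative_G_E)
qed

lemma dual_vector_in_frame:
  "y \<in> fst c \<Longrightarrow> snd c y \<in> S \<Longrightarrow> k \<noteq> k0 \<Longrightarrow> dual (b k) y (dual_vector (b k) y)"
  unfolding dual_vector_def by (rule someI[where P = "dual (b k) y", OF dual_lift_E])

text \<open>As \<open>X\<close> is a multiple of \<open>E k0\<close>, the unknown multiple of
  \<open>E k0\<close> in the chosen dual vector cancels in the antisymmetric expression. Only smooth
  data remain.\<close>

lemma poisson_covectors:
  assumes y: "y \<in> fst c" "snd c y \<in> S" and k: "k \<noteq> k0" and L: "linear L" "linear L'"
  shows "poisson (b k) y [covector c y L, covector c y L'] = u (snd c y) *
    (L (E k (snd c y)) * L' (E k0 (snd c y)) - L (E k0 (snd c y)) * L' (E k (snd c y)))"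
proof -
  let ?Y = "dual_vector (b k) y"
  have Y: "dual (b k) y ?Y"
    by (rule dual_vector_in_frame[OF y k])
  have cov: "covector c y L (X y) = u (snd c y) * L (E k0 (snd c y))"
    "covector c y L ?Y = L (E k (snd c y)) + (?Y c $ l) * L (E k0 (snd c y))" if "linear L" for L
  proof -
    show "covector c y L (X y) = u (snd c y) * L (E k0 (snd c y))"
      using X_tangent in_U[OF y] U_subset X_eq_E[OF y]
      by (auto simp: covector_def linear_scale[OF that])
    have "L (?Y c) = L (E k (snd c y)) + (?Y c $ l) * L (E k0 (snd c y))"
      by (subst dual_eq_E[OF y k Y]) (simp add: linear_add[OF that] linear_scale[OF that])
    then show "covector c y L ?Y = L (E k (snd c y)) + (?Y c $ l) * L (E k0 (snd c y))"
      using Y by (simp add: covector_def dual_def)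
  qed
  show ?thesis
    unfolding poisson_apply[OF in_U[OF y] covector_in_cotangent_space[OF L(1)]
        covector_in_cotangent_space[OF L(2)]] cov[OF L(1)] cov[OF L(2)]
    by (simp add: algebra_simps)
qed

lemma poisson_differentials:
  assumes y: "y \<in> fst c" "snd c y \<in> S" and k: "k \<noteq> k0"
    and V: "openin M V" "y \<in> V" and fg: "smooth_map_on A V f" "smooth_map_on A V g"
  shows "poisson (b k) y [differential A f y, differential A g y] =
    bracket u k0 k (f \<circ> chart_inv c) (g \<circ> chart_inv c) (snd c y)"
proof -
  have lin: "linear (frechet_derivative (f \<circ> chart_inv c) (at (snd c y)))"
    if "smooth_map_on A V f" for f :: "'a \<Rightarrow> real"
    by (rule has_derivative_linear[OF Cinf_on_imp_has_derivative[OF smooth_map_onD[OF that c_in]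
            open_image_chart[OF c_in V(1)]]])
      (use y V in blast)
  show ?thesis
    unfolding differential_eq_covector[OF V fg(1) c_in y(1)] differential_eq_covector[OF V fg(2) c_in y(1)]
      poisson_covectors[OF y k lin[OF fg(1)] lin[OF fg(2)]] bracket_def lie_def ..
qed

text \<open>An identity at all points of the open set \<open>S\<close> can be differentiated, as the
  outer bracket of a nested pair requires.\<close>

lemma poisson_differentials_chart:
  assumes k: "k \<noteq> k0" and V: "openin M V" "S \<subseteq> snd c ` (fst c \<inter> V)"
    and fg: "smooth_map_on A V f" "smooth_map_on A V g" and p: "p \<in> S"
  shows "((\<lambda>y. poisson (b k) y [differential A f y, differential A g y]) \<circ> chart_inv c) p =
    bracket u k0 k (f \<circ> chart_inv c) (g \<circ> chart_inv c) p"
proof -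
  obtain y where y: "y \<in> fst c" "y \<in> V" "p = snd c y"
    using V(2) p by blast
  show ?thesis
    using poisson_differentials[OF y(1) _ k V(1) y(2) fg] p y c_in by simp
qed

lemma Cinf_on_bracket:
  assumes "Cinf_on S f" "Cinf_on S g"
  shows "Cinf_on S (bracket u k0 k f g)"
  unfolding bracket_def[abs_def]
  by (intro Cinf_on_mult Cinf_on_diff Cinf_on_lie open_S smooth_u smooth_E assms)

lemma ex_coefficients:
  assumes y: "y \<in> fst c" "snd c y \<in> S" and \<alpha>: "\<alpha> \<in> cotangent_space A y"
  shows "\<exists>r. \<alpha> = (\<Sum>k\<in>UNIV. r k *\<^sub>R covector c y (frechet_derivative (coord l c k) (at (snd c y))))"
proof (intro exI ext)
  fix v
  let ?D = "\<lambda>k. frechet_derivative (coord l c k) (at (snd c y))"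
  \<comment> \<open>The coefficients are the values of \<open>\<alpha>\<close> on the dual
    frame.\<close>
  show "\<alpha> v = (\<Sum>k\<in>UNIV. \<alpha> (lift c y (E k (snd c y))) *\<^sub>R covector c y (?D k)) v"
  proof (cases "v \<in> tangent_space A y")
    case True
    have lin: "linear (\<lambda>w. \<alpha> (lift c y w))"
      by (rule linear_cotangent_lift[OF \<alpha> c_in y(1)])
    have "\<alpha> v = \<alpha> (lift c y (v c))"
      using lift_tangent[OF True c_in y(1)] by simp
    also have "\<dots> = \<alpha> (lift c y (\<Sum>k\<in>UNIV. ?D k (v c) *\<^sub>R E k (snd c y)))"
      using eq_sum_E[OF y(2), of "v c"] by simp
    also have "\<dots> = (\<Sum>k\<in>UNIV. ?D k (v c) * \<alpha> (lift c y (E k (snd c y))))"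
      using linear_sum[OF lin, of "\<lambda>k. ?D k (v c) *\<^sub>R E k (snd c y)" UNIV] linear_scale[OF lin] by simp
    finally show ?thesis
      using True by (simp add: sum_fun_eval scaleR_fun_eval covector_def mult.commute)
  next
    case False
    then show ?thesis
      using \<alpha> by (simp add: sum_fun_eval scaleR_fun_eval covector_def cotangent_space_def)
  qed
qed

end

section \<open>From local frames to statements on the whole open set\<close>

context first_integrals
begin

text \<open>The set \<open>V\<close> allows the frame to be placed inside the common domain of given
  local functions.\<close>

lemma ex_integral_frame:
  assumes "openin M V" "x \<in> V" "V \<subseteq> U" "c \<in> A" "x \<in> fst c"
  obtains l S where "snd c x \<in> S" "S \<subseteq> snd c ` (fst c \<inter> V)" "integral_frame M A m X h U b k0 c l S"
proof -
  obtain l S where lS: "snd c x \<in> S" "S \<subseteq> snd c ` (fst c \<inter> V)" "coordinate_functions S (coord l c)"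
    using ex_coordinate_functions[OF assms] by blast
  have "S \<subseteq> snd c ` (fst c \<inter> U)"
    using lS(2) assms(3) by blast
  then have "integral_frame M A m X h U b k0 c l S"
    by (intro integral_frame.intro integral_frame_axioms.intro first_integrals_axioms assms(4) lS(3))
  then show thesis
    using that lS by blast
qed

lemma dual_dual_vector:
  assumes "x \<in> U" "i \<in> {1..m - 1}"
  shows "dual i x (dual_vector i x)"
proof -
  obtain c where c: "c \<in> A" "x \<in> fst c"
    using assms(1) ex_chart U_subset by blast
  obtain l S where S: "snd c x \<in> S" "S \<subseteq> snd c ` (fst c \<inter> U)"
    and "integral_frame M A m X h U b k0 c l S"
    using ex_integral_frame[OF openin_U assms(1) order_refl c] .
  then interpret integral_frame M A m X h U b k0 c l S by simp
  obtain k where "k \<noteq> k0" "i = b k"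
    using ex_index[OF assms(2)] .
  then show ?thesis
    using dual_vector_in_frame[OF c(2) S(1)] by simp
qed

text \<open>In a frame near each point the tested function is a \<open>bracket\<close> of smooth
  functions. Since \<open>l\<close> and \<open>S\<close> change with the point, smoothness is
  obtained locally and then patched.\<close>

lemma poisson_field:
  assumes i: "i \<in> {1..m - 1}"
  shows "multivector_field M A U 2 (poisson i)"
  unfolding multivector_field_def
proof (intro conjI allI ballI impI)
  fix V and fs :: "('a \<Rightarrow> real) list"
  assume *: "openin M V \<and> V \<subseteq> U \<and> length fs = 2 \<and> (\<forall>f\<in>set fs. smooth_map_on A V f)"
  then obtain f g where fs: "fs = [f, g]"
    by (auto simp: numeral_2_eq_2 length_Suc_conv)
  then have V: "openin M V" "V \<subseteq> U" and fg: "smooth_map_on A V f" "smooth_map_on A V g"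
    using * by auto
  obtain k where k: "k \<noteq> k0" "i = b k"
    using ex_index[OF i] .
  let ?F = "\<lambda>x. poisson i x [differential A f x, differential A g x]"
  have "Cinf_on (snd c ` (fst c \<inter> V)) (?F \<circ> chart_inv c)" if c: "c \<in> A" for c
  proof (rule Cinf_on_local[OF open_image_chart[OF c V(1)]])
    fix p assume "p \<in> snd c ` (fst c \<inter> V)"
    then obtain x where x: "x \<in> fst c" "x \<in> V" "p = snd c x" by blast
    obtain l S where S: "snd c x \<in> S" "S \<subseteq> snd c ` (fst c \<inter> V)"
      and "integral_frame M A m X h U b k0 c l S"
      using ex_integral_frame[OF V(1) x(2) V(2) c x(1)] .
    then interpret integral_frame M A m X h U b k0 c l S by simp
    have "Cinf_on S (f \<circ> chart_inv c)" "Cinf_on S (g \<circ> chart_inv c)"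
      using fg[THEN smooth_map_onD, OF c] S(2) Cinf_on_subset by blast+
    then have "Cinf_on S (bracket u k0 k (f \<circ> chart_inv c) (g \<circ> chart_inv c))"
      by (rule Cinf_on_bracket)
    moreover have "Cinf_on S (?F \<circ> chart_inv c) \<longleftrightarrow>
        Cinf_on S (bracket u k0 k (f \<circ> chart_inv c) (g \<circ> chart_inv c))"
      using poisson_differentials_chart[OF k(1) V(1) S(2) fg, folded k(2)]
      by (rule Cinf_on_cong[OF open_S])
    ultimately have "Cinf_on S (?F \<circ> chart_inv c)" by blast
    then show "\<exists>T. open T \<and> p \<in> T \<and> Cinf_on T (?F \<circ> chart_inv c)"
      using open_S S(1) x(3) by blast
  qed
  then show "smooth_map_on A V (\<lambda>x. poisson i x (map (\<lambda>f. differential A f x) fs))"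
    by (simp add: smooth_map_on_def fs)
qed (simp_all add: poisson_multivector poisson_outside)

lemma smooth_poisson:
  assumes "i \<in> {1..m - 1}" "openin M V" "V \<subseteq> U" "smooth_map_on A V f" "smooth_map_on A V g"
  shows "smooth_map_on A V (\<lambda>x. poisson i x [differential A f x, differential A g x])"
proof -
  have "openin M V \<and> V \<subseteq> U \<and> length [f, g] = 2 \<and> (\<forall>f\<in>set [f, g]. smooth_map_on A V f)"
    using assms by simp
  then have "smooth_map_on A V (\<lambda>x. poisson i x (map (\<lambda>f. differential A f x) [f, g]))"
    using poisson_field[OF assms(1)] unfolding multivector_field_def by blast
  then show ?thesis by simp
qed

lemma schouten_on_functions_poisson:
  assumes ij: "i \<in> {1..m - 1}" "j \<in> {1..m - 1}" and V: "openin M V" "x \<in> V" "V \<subseteq> U"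
    and fge: "smooth_map_on A V f" "smooth_map_on A V g" "smooth_map_on A V e"
  shows "schouten_on_functions A 2 (poisson i) 2 (poisson j) [f, g, e] x = 0"
proof -
  obtain c where c: "c \<in> A" "x \<in> fst c"
    using V ex_chart openin_subset by blast
  obtain l S where S: "snd c x \<in> S" "S \<subseteq> snd c ` (fst c \<inter> V)"
    and "integral_frame M A m X h U b k0 c l S"
    using ex_integral_frame[OF V c] .
  then interpret integral_frame M A m X h U b k0 c l S by simp
  have smooth: "Cinf_on S (f \<circ> chart_inv c)" if "smooth_map_on A V f" for f :: "'a \<Rightarrow> real"
    using Cinf_on_subset[OF smooth_map_onD[OF that c(1)] S(2)] .
  \<comment> \<open>Generalised over indices and functions because each of the two insertions
    contributes three such terms.\<close>
  have iter: "poisson j x [differential A (\<lambda>y. poisson i y [differential A f y, differential A g y]) x,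
        differential A e x] =
      bracket u k0 q (bracket u k0 k (f \<circ> chart_inv c) (g \<circ> chart_inv c)) (e \<circ> chart_inv c) (snd c x)"
    if k: "k \<noteq> k0" "i = b k" and q: "q \<noteq> k0" "j = b q" and i: "i \<in> {1..m - 1}"
      and fge: "smooth_map_on A V f" "smooth_map_on A V g" "smooth_map_on A V e" for i j k q f g e
  proof -
    let ?F = "\<lambda>y. poisson i y [differential A f y, differential A g y]"
    have "lie (E n) (?F \<circ> chart_inv c) (snd c x) =
        lie (E n) (bracket u k0 k (f \<circ> chart_inv c) (g \<circ> chart_inv c)) (snd c x)" for n
      by (rule lie_cong[OF open_S S(1)])
        (rule poisson_differentials_chart[OF k(1) V(1) S(2) fge(1,2), folded k(2)])
    then show ?thesis
      using poisson_differentials[OF c(2) S(1) q(1) V(1,2) smooth_poisson[OF i V(1,3) fge(1,2)] fge(3)]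
      by (simp add: q(2) bracket_def[of u k0 q])
  qed
  obtain k q where k: "k \<noteq> k0" "i = b k" and q: "q \<noteq> k0" "j = b q"
    using ex_index[OF ij(1)] ex_index[OF ij(2)] by metis
  \<comment> \<open>With both degrees equal to 2 the exponent in
    \<open>schouten_on_functions\<close> is 9, so the difference of the insertions is a sum, as in
    \<open>bracket_jacobiator\<close>.\<close>
  show ?thesis
    using bracket_jacobiator[OF S(1) smooth_u smooth[OF fge(1)] smooth[OF fge(2)] smooth[OF fge(3)], of k0 k q]
    unfolding schouten_on_functions_def insertion_bivectors
      iter[OF k q ij(1) fge] iter[OF k q ij(1) fge(1,3,2)] iter[OF k q ij(1) fge(2,3,1)]
      iter[OF q k ij(2) fge] iter[OF q k ij(2) fge(1,3,2)] iter[OF q k ij(2) fge(2,3,1)]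
    by simp
qed

lemma schouten_poisson:
  assumes ij: "i \<in> {1..m - 1}" "j \<in> {1..m - 1}"
  shows "schouten M A U 2 (poisson i) 2 (poisson j) = 0"
proof (rule schouten_eq_0I[OF U_subset])
  fix x and fs :: "('a \<Rightarrow> real) list"
  assume x: "x \<in> U" and len: "length fs = 2 + 2 - 1"
    and loc: "\<And>f. f \<in> set fs \<Longrightarrow> \<exists>V. openin M V \<and> x \<in> V \<and> smooth_map_on A V f"
  obtain f g e where fs: "fs = [f, g, e]"
    using len by (auto simp: numeral_2_eq_2 length_Suc_conv)
  obtain V1 V2 V3 where V: "openin M V1" "x \<in> V1" "smooth_map_on A V1 f"
    "openin M V2" "x \<in> V2" "smooth_map_on A V2 g" "openin M V3" "x \<in> V3" "smooth_map_on A V3 e"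
    using loc[of f] loc[of g] loc[of e] fs by auto
  \<comment> \<open>Each function comes with its own neighbourhood of \<open>x\<close>; the frame
    needs a common one inside \<open>U\<close>.\<close>
  let ?V = "U \<inter> (V1 \<inter> (V2 \<inter> V3))"
  show "schouten_on_functions A 2 (poisson i) 2 (poisson j) fs x = 0"
    unfolding fs
  proof (rule schouten_on_functions_poisson[OF ij])
    show "openin M ?V"
      using V openin_U by (intro openin_Int)
    show "smooth_map_on A ?V f" by (rule smooth_map_on_subset[OF V(3)]) blast
    show "smooth_map_on A ?V g" by (rule smooth_map_on_subset[OF V(6)]) blast
    show "smooth_map_on A ?V e" by (rule smooth_map_on_subset[OF V(9)]) blast
    show "x \<in> ?V" using x V(2,5,8) by blast
  qed blast
qed

lemma sharp_poisson:
  assumes x: "x \<in> U" and i: "i \<in> {1..m - 1}" and \<alpha>: "\<alpha> \<in> cotangent_space A x"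
  shows "sharp A (poisson i) x \<alpha> = \<alpha> (dual_vector i x) *\<^sub>R X x - \<alpha> (X x) *\<^sub>R dual_vector i x"
proof (rule sharp_eqI)
  have X: "X x \<in> tangent_space A x"
    using X_tangent x U_subset by blast
  have Y: "dual_vector i x \<in> tangent_space A x"
    using dual_dual_vector[OF x i] by (simp add: dual_def)
  show "x \<in> topspace M"
    using x U_subset by blast
  show "\<alpha> (dual_vector i x) *\<^sub>R X x - \<alpha> (X x) *\<^sub>R dual_vector i x \<in> tangent_space A x"
    by (intro tangent_space_diff tangent_space_scaleR X Y)
  show "\<beta> (\<alpha> (dual_vector i x) *\<^sub>R X x - \<alpha> (X x) *\<^sub>R dual_vector i x) = poisson i x [\<alpha>, \<beta>]"
    if "\<beta> \<in> cotangent_space A x" for \<beta>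
    unfolding poisson_apply[OF x \<alpha> that] cotangent_diff[OF that tangent_space_scaleR[OF X] tangent_space_scaleR[OF Y]]
      cotangent_scaleR[OF that X] cotangent_scaleR[OF that Y] ..
qed

lemma sharp_poisson_h:
  assumes "x \<in> U" "i \<in> {1..m - 1}" "j \<in> {1..m - 1}"
  shows "sharp A (poisson i) x (differential A (h j) x) = (if i = j then 1 else 0) *\<^sub>R X x"
proof -
  have x: "x \<in> topspace M"
    using assms(1) U_subset by blast
  have "differential A (h j) x (dual_vector i x) = (if i = j then 1 else 0)"
    using dual_dual_vector[OF assms(1,2)] assms(3) by (simp add: dual_def)
  then show ?thesis
    unfolding sharp_poisson[OF assms(1,2) differential_h_cotangent[OF assms(3) x]]
      differential_h_X[OF assms(3) x] scaleR_zero_left by simp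
qed

lemma rank_poisson:
  assumes "x \<in> U" "i \<in> {1..m - 1}"
  shows "bivector_rank A (poisson i) x \<le> 2"
proof -
  have "sharp A (poisson i) x ` cotangent_space A x \<subseteq> span {X x, dual_vector i x}"
  proof
    fix v assume "v \<in> sharp A (poisson i) x ` cotangent_space A x"
    then obtain \<alpha> where "v = \<alpha> (dual_vector i x) *\<^sub>R X x - \<alpha> (X x) *\<^sub>R dual_vector i x"
      using sharp_poisson[OF assms] by blast
    then show "v \<in> span {X x, dual_vector i x}"
      by (simp only:) (intro span_diff span_scale span_base; blast)
  qed
  then have "bivector_rank A (poisson i) x \<le> card {X x, dual_vector i x}"
    unfolding bivector_rank_def by (rule dim_le_card) simp
  also have "\<dots> \<le> 2"
    by (simp add: card_insert_if)
  finally show ?thesis .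
qed

lemma bivector_unique:
  assumes x: "x \<in> U" and P: "P x \<in> multivectors A 2 x" and Q: "Q x \<in> multivectors A 2 x"
    and eq: "\<And>j. j \<in> {1..m - 1} \<Longrightarrow>
      sharp A P x (differential A (h j) x) = sharp A Q x (differential A (h j) x)"
  shows "P x = Q x"
proof -
  have xM: "x \<in> topspace M"
    using x U_subset by blast
  obtain c where c: "c \<in> A" "x \<in> fst c"
    using xM ex_chart by blast
  obtain l S where S: "snd c x \<in> S" and "S \<subseteq> snd c ` (fst c \<inter> U)"
    and "integral_frame M A m X h U b k0 c l S"
    using ex_integral_frame[OF openin_U x order_refl c] .
  then interpret integral_frame M A m X h U b k0 c l S by simp
  define \<theta> where "\<theta> k = covector c x (frechet_derivative (coord l c k) (at (snd c x)))" for k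
  have \<theta>: "\<theta> k \<in> cotangent_space A x" for k
    unfolding \<theta>_def by (rule covector_in_cotangent_space[OF linear_derivative_coord[OF S]])
  \<comment> \<open>Equal images under \<open>sharp\<close> mean equal values for a first argument
    dh_j and an arbitrary second argument.\<close>
  have left: "P x [\<theta> k, \<beta>] = Q x [\<theta> k, \<beta>]" if "k \<noteq> k0" "\<beta> \<in> cotangent_space A x" for k \<beta>
    using sharp_works[where P = P, OF xM P \<theta> that(2), of k] sharp_works[where P = Q, OF xM Q \<theta> that(2), of k]
      eq[OF b_in[OF that(1)]] differential_h_coord[OF c(2) S that(1)] by (simp add: \<theta>_def)
  have "P x [\<theta> k, \<theta> q] = Q x [\<theta> k, \<theta> q]" for k q
  proof -
    \<comment> \<open>If neither index differs from \<open>k0\<close>, the two coincide and both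
      values are 0 by alternation.\<close>
    consider "k \<noteq> k0" | "q \<noteq> k0" | "k = q" by blast
    then show ?thesis
    proof cases
      case 2
      then show ?thesis
        using left[OF 2 \<theta>[of k]] bivector_antisym[OF P \<theta>[of k] \<theta>[of q]] bivector_antisym[OF Q \<theta>[of k] \<theta>[of q]]
        by simp
    next
      case 3
      then show ?thesis
        using bivector_diag[OF P \<theta>] bivector_diag[OF Q \<theta>] by simp
    qed (rule left[OF _ \<theta>])
  qed
  moreover have "\<exists>r. \<alpha> = (\<Sum>k\<in>UNIV. r k *\<^sub>R \<theta> k)" if "\<alpha> \<in> cotangent_space A x" for \<alpha>
    unfolding \<theta>_def by (rule ex_coefficients[OF c(2) S that])
  ultimately show ?thesis
    using \<theta> by (intro bivector_eqI[OF P Q, where \<theta> = \<theta> and I = UNIV])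
qed

lemma poisson_structure_poisson: "i \<in> {1..m - 1} \<Longrightarrow> poisson_structure M A U (poisson i)"
  by (simp add: poisson_structure_def poisson_field schouten_poisson)

end

theorem theorem3p1:
  fixes M :: "'a topology"
    and A :: "('a, 'n::finite) chart set"
    and m :: nat
    and X :: "'a \<Rightarrow> ('a, 'n) tangent"
    and h :: "nat \<Rightarrow> 'a \<Rightarrow> real"
    and U :: "'a set"
  assumes "m = CARD('n)"
    and "smooth_manifold M A"
    and "orientable A"
    and "vector_field A (topspace M) X"
    and "\<forall>i\<in>{1..m - 1}. first_integral A (topspace M) X (h i)"
    and "openin M U"
    and "M closure_of U = topspace M"
    and "independent_functions_on A U {1..m - 1} h"
  shows
    "let is_solution = (\<lambda>\<pi>.
           \<pi> \<in> {1..m - 1} \<rightarrow>\<^sub>E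
                 {P. poisson_structure M A U P \<and> (\<forall>x\<in>U. bivector_rank A P x \<le> 2)} \<and>
           (\<forall>i\<in>{1..m - 1}. \<forall>j\<in>{1..m - 1}. \<forall>x\<in>U.
              sharp A (\<pi> i) x (differential A (h j) x) = (if i = j then 1 else 0) *\<^sub>R X x))
     in (\<exists>!\<pi>. is_solution \<pi>) \<and>
        (\<forall>\<pi>. is_solution \<pi> \<longrightarrow>
           (\<forall>i\<in>{1..m - 1}. \<forall>j\<in>{1..m - 1}. schouten M A U 2 (\<pi> i) 2 (\<pi> j) = 0))"
proof -
  \<comment> \<open>Any index may be set aside for the completing function; \<open>m - 1\<close>
    indices are left for the integrals.\<close>
  define k0 :: 'n where "k0 = undefined"
  have "card (- {k0}) = card {1..m - 1}"
    by (simp add: Compl_eq_Diff_UNIV card_Diff_singleton assms(1))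
  then obtain b where b: "bij_betw b (- {k0}) {1..m - 1}"
    using finite_same_card_bij[of "- {k0}" "{1..m - 1}"] by auto
  interpret first_integrals M A m X h U b k0
    using assms b by unfold_locales auto
  define sol where "sol \<pi> \<longleftrightarrow>
      \<pi> \<in> {1..m - 1} \<rightarrow>\<^sub>E
           {P. poisson_structure M A U P \<and> (\<forall>x\<in>U. bivector_rank A P x \<le> 2)} \<and>
      (\<forall>i\<in>{1..m - 1}. \<forall>j\<in>{1..m - 1}. \<forall>x\<in>U.
          sharp A (\<pi> i) x (differential A (h j) x) = (if i = j then 1 else 0) *\<^sub>R X x)" for \<pi>
  \<comment> \<open>Families are compared in an extensional function space, so the values off the
    index set have to be the default ones.\<close>
  let ?\<pi> = "restrict poisson {1..m - 1}"
  have ex: "sol ?\<pi>"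
    unfolding sol_def by (auto simp: poisson_structure_poisson rank_poisson sharp_poisson_h)
  have unique: "\<pi> = ?\<pi>" if "sol \<pi>" for \<pi>
  proof (rule extensionalityI)
    show "\<pi> \<in> extensional {1..m - 1}"
      using that by (simp add: sol_def PiE_def)
    show "?\<pi> \<in> extensional {1..m - 1}"
      by simp
    fix i assume i: "i \<in> {1..m - 1}"
    have field: "multivector_field M A U 2 (\<pi> i)"
      using that i by (auto simp: sol_def poisson_structure_def dest: PiE_mem)
    \<comment> \<open>Fields on \<open>U\<close> are 0 elsewhere by convention, so agreement on
      \<open>U\<close> yields equality as functions.\<close>
    have "\<pi> i x = poisson i x" for x
    proof (cases "x \<in> U")
      case True
      have "\<pi> i x \<in> multivectors A 2 x"
        using field True by (simp add: multivector_field_def)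
      moreover have "sharp A (\<pi> i) x (differential A (h j) x) = sharp A (poisson i) x (differential A (h j) x)"
        if "j \<in> {1..m - 1}" for j
        using \<open>sol \<pi>\<close> i that True sharp_poisson_h[OF True i that] by (simp add: sol_def)
      ultimately show ?thesis
        by (intro bivector_unique[where P = "\<pi> i" and Q = "poisson i"] True poisson_multivector)
    next
      case False
      then show ?thesis
        using field by (simp add: multivector_field_def poisson_outside)
    qed
    then show "\<pi> i = ?\<pi> i"
      using i by (simp add: fun_eq_iff)
  qed
  have "\<exists>!\<pi>. sol \<pi>"
    using ex unique by (rule ex1I)
  moreover have "\<forall>\<pi>. sol \<pi> \<longrightarrow> (\<forall>i\<in>{1..m - 1}. \<forall>j\<in>{1..m - 1}. schouten M A U 2 (\<pi> i) 2 (\<pi> j) = 0)"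
  proof (intro allI impI ballI)
    fix \<pi> i j assume "sol \<pi>" and ij: "i \<in> {1..m - 1}" "j \<in> {1..m - 1}"
    have "schouten M A U 2 (?\<pi> i) 2 (?\<pi> j) = 0"
      unfolding restrict_apply'[OF ij(1)] restrict_apply'[OF ij(2)] by (rule schouten_poisson[OF ij])
    then show "schouten M A U 2 (\<pi> i) 2 (\<pi> j) = 0"
      unfolding unique[OF \<open>sol \<pi>\<close>, symmetric] .
  qed
  ultimately show ?thesis
    unfolding sol_def Let_def by (rule conjI)
qed

end
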